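(* Let $a\geq 1$, $b\geq 0$ and $k\geq 2$ be integers. Then either $\sigma(an+b)$ is not a perfect $k$th power for any natural number $n$, or $\sigma(an+b)$ is a perfect $k$th power for infinitely many natural numbers $n$.
   Context: $\sigma(m)$ denotes the sum of the positive divisors of $m$. Natural numbers are $\{1,2,3,\ldots\}$. *)

theory Defs
  imports Main
begin

definition sigma :: "nat \<Rightarrow> nat" where
  "sigma m = (\<Sum>d \<in> {d. d dvd m}. d)"

definition is_kth_power :: "nat \<Rightarrow> nat \<Rightarrow> bool" where
  "is_kth_power k x \<longleftrightarrow> (\<exists>y::nat. x = y ^ k)"

end

(*
  If sigma N is a k-th power and S is a finite set of primes not dividing N such that the product of
  p + 1 over S is a k-th power and the product of S is 1 modulo a, then N * \<Prod>S lies in the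
  same residue class as N and sigma (N * \<Prod>S) is again a k-th power. The congruence is free:
  among the unions of the first n of a sequence of disjoint such sets, two have the same product
  modulo a, and their difference is the required S.

  To find S avoiding a given finite set, consider the primes p \<le> x for which p + 1 has all prime
  factors at most x/c, where c = 2^j. A zero-sum theorem for (Z/k)^t with a bound linear in t (the
  character argument of Alford, Granville and Pomerance) provides S as soon as there are more than
  R_k \<pi>(x/c) such primes. By Chebyshev's bounds it suffices that they make up a fixed proportion
  of the primes up to x, for c large. The other primes satisfy p + 1 = m q with q prime and m \<le> c,
  and Brun's pure sieve shows that for each m there are only o(x / log x) of them.
*)
theory Submission
  imports Defs "HOL-Computational_Algebra.Nth_Powers" "HOL-Number_Theory.Number_Theory"
    "HOL-Real_Asymp.Real_Asymp" "HOL-Analysis.Harmonic_Numbers"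
begin

section \<open>Zero-sum subfamilies\<close>

text \<open>Greedy choice: \<open>\<alpha> i\<close> is the value that \<open>f i\<close> takes most
  often on the elements of \<open>U\<close> avoiding all earlier choices. There are only
  \<open>k\<close> candidates, so each choice removes at least a fraction \<open>1 / k\<close> of
  the survivors.\<close>

lemma root_of_unity_avoidance:
  fixes f :: "'i \<Rightarrow> 'u \<Rightarrow> complex"
  assumes "finite I" "finite U" "k > 0"
    and "\<And>i u. f i u ^ k = 1"
  shows "\<exists>\<alpha>. (\<forall>i\<in>I. \<alpha> i ^ k = 1) \<and>
    real (card {u\<in>U. \<forall>i\<in>I. f i u \<noteq> \<alpha> i}) \<le> real (card U) * (1 - 1 / real k) ^ card I"
  using \<open>finite I\<close>
proof (induction I rule: finite_induct)
  case empty
  then show ?case by simp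
next
  case (insert i I)
  then obtain \<alpha> where \<alpha>: "\<forall>i\<in>I. \<alpha> i ^ k = 1"
    "real (card {u\<in>U. \<forall>i\<in>I. f i u \<noteq> \<alpha> i}) \<le> real (card U) * (1 - 1 / real k) ^ card I"
    by blast
  define R where "R = {u\<in>U. \<forall>i\<in>I. f i u \<noteq> \<alpha> i}"
  let ?Z = "{z::complex. z ^ k = 1}"
  have R: "finite R" using assms by (simp add: R_def)
  have cZ: "card ?Z = k" using card_roots_unity_eq assms by simp
  have Z: "finite ?Z" "?Z \<noteq> {}" using finite_roots_unity[of k] assms by (auto intro: exI[of _ 1])
  have "\<exists>y\<in>?Z. card (f i -` {y} \<inter> R) * card ?Z \<ge> card R"
    using assms Z R by (intro pigeonhole_card) auto
  then obtain y where y: "y ^ k = 1" "card (f i -` {y} \<inter> R) * k \<ge> card R"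
    unfolding cZ by blast
  have "{u\<in>U. \<forall>j\<in>insert i I. f j u \<noteq> (\<alpha>(i := y)) j} = R - (f i -` {y} \<inter> R)"
    using insert.hyps by (auto simp: R_def)
  then have "real (card {u\<in>U. \<forall>j\<in>insert i I. f j u \<noteq> (\<alpha>(i := y)) j})
      = real (card R) - real (card (f i -` {y} \<inter> R))"
    using R by (simp add: card_Diff_subset of_nat_diff card_mono)
  also have "real (card R) / real k \<le> real (card (f i -` {y} \<inter> R))"
    using y(2) assms(3) by (simp add: divide_le_eq flip: of_nat_mult)
  then have "real (card R) - real (card (f i -` {y} \<inter> R)) \<le> real (card R) * (1 - 1 / real k)"
    by (simp add: algebra_simps)
  also have "\<dots> \<le> real (card U) * (1 - 1 / real k) ^ card I * (1 - 1 / real k)"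
    using \<alpha>(2) assms(3) unfolding R_def by (intro mult_right_mono) auto
  finally show ?case
    using \<alpha>(1) y(1) insert.hyps
    by (intro exI[of _ "\<alpha>(i := y)"]) (auto simp: algebra_simps)
qed

text \<open>Orthogonality of the characters of Z/k: unless \<open>k\<close> divides
  \<open>n\<close>, the root \<open>w ^ n\<close> differs from 1, and the geometric sum vanishes
  because its \<open>k\<close>-th power is 1.\<close>

lemma sum_root_of_unity_powers:
  assumes "k > 0"
  shows "(\<Sum>j<k. cis (2 * pi / real k) ^ (j * n)) = (if k dvd n then of_nat k else 0)"
proof -
  define w where "w = cis (2 * pi / real k)"
  have pow: "w ^ m = cis (2 * pi * real m / real k)" for m
    unfolding w_def Complex.DeMoivre by (simp add: mult_ac)
  have wk: "w ^ k = 1" using assms by (simp add: pow)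
  have one: "w ^ n = 1 \<longleftrightarrow> k dvd n"
  proof
    assume "k dvd n" then show "w ^ n = 1" using wk by (metis dvd_def power_mult power_one)
  next
    assume *: "w ^ n = 1"
    have "w ^ n = w ^ (k * (n div k) + n mod k)" by simp
    also have "\<dots> = w ^ (n mod k)" by (simp only: power_add power_mult wk) simp
    finally have "w ^ (n mod k) = w ^ 0" using * by simp
    then have "cis (2 * pi * real (n mod k) / real k) = cis (2 * pi * real 0 / real k)"
      unfolding pow .
    with Complex.bij_betw_roots_unity[OF assms] have "n mod k = 0"
      using assms unfolding bij_betw_def inj_on_def by (meson lessThan_iff mod_less_divisor)
    then show "k dvd n" by auto
  qed
  have eq: "(\<Sum>j<k. w ^ (j * n)) = (\<Sum>j<k. (w ^ n) ^ j)"
    by (simp add: mult.commute flip: power_mult)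
  show ?thesis
  proof (cases "k dvd n")
    case True then show ?thesis using one eq by (simp add: w_def)
  next
    case False
    then have "(\<Sum>j<k. (w ^ n) ^ j) = ((w ^ n) ^ k - 1) / (w ^ n - 1)"
      using one by (intro geometric_sum) simp
    also have "(w ^ n) ^ k = 1" by (metis mult.commute power_mult power_one wk)
    finally show ?thesis using eq False by (simp add: w_def)
  qed
qed

text \<open>
  If the roots of unity \<open>\<alpha> i\<close> are chosen such that every character takes the value \<open>\<alpha> i\<close> at some
  \<open>v i\<close>, then \<open>\<Prod>i. (\<alpha> i - ch (v i))\<close> vanishes for every character \<open>ch\<close>. Averaging the expanded product
  over all characters leaves only the zero-sum subfamilies, and the empty one cannot be alone.
\<close>
lemma zero_sum_subfamily:
  fixes v :: "'i \<Rightarrow> 'q \<Rightarrow> nat"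
  assumes fin: "finite P" "finite I" and k: "k > 0"
    and small: "real k ^ card P * (1 - 1 / real k) ^ card I < 1"
  shows "\<exists>S\<subseteq>I. S \<noteq> {} \<and> (\<forall>q\<in>P. k dvd (\<Sum>i\<in>S. v i q))"
proof (rule ccontr)
  assume contra: "\<not> ?thesis"
  define U where "U = PiE P (\<lambda>_. {..<k})"
  define w where "w = cis (2 * pi / real k)"
  \<comment> \<open>\<open>U\<close> indexes the characters of (Z/k)^P, and \<open>ch i u\<close> is
    the value of the character \<open>u\<close> at the vector \<open>v i\<close>.\<close>
  define ch where "ch = (\<lambda>i u. w ^ (\<Sum>q\<in>P. u q * v i q))"
  have finU: "finite U" unfolding U_def using fin by (intro finite_PiE) auto
  have cardU: "card U = k ^ card P" unfolding U_def using fin by (simp add: card_PiE)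
  have wk: "w ^ k = 1" using k unfolding w_def Complex.DeMoivre by simp
  have chk: "ch i u ^ k = 1" for i u
    unfolding ch_def by (metis mult.commute power_mult power_one wk)
  obtain \<alpha> where \<alpha>: "\<forall>i\<in>I. \<alpha> i ^ k = 1"
    "real (card {u\<in>U. \<forall>i\<in>I. ch i u \<noteq> \<alpha> i}) \<le> real (card U) * (1 - 1 / real k) ^ card I"
    using root_of_unity_avoidance[OF fin(2) finU k, of ch] chk by blast
  then have "real (card {u\<in>U. \<forall>i\<in>I. ch i u \<noteq> \<alpha> i}) < 1"
    using small cardU by simp
  then have "{u\<in>U. \<forall>i\<in>I. ch i u \<noteq> \<alpha> i} = {}" using finU by simp
  then have "(\<Sum>u\<in>U. \<Prod>i\<in>I. \<alpha> i - ch i u) = 0"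
    using fin by (intro sum.neutral ballI prod_zero) force+
  moreover have "(\<Sum>u\<in>U. \<Prod>i\<in>I. \<alpha> i - ch i u)
      = (\<Sum>X\<in>Pow I. (-1) ^ card X * (\<Prod>i\<in>I-X. \<alpha> i) * (\<Sum>u\<in>U. \<Prod>i\<in>X. ch i u))"
    unfolding prod_diff_conv_sum[OF fin(2)] 
    by (subst sum.swap) (simp add: sum_distrib_left mult_ac)
  moreover have "(\<Sum>u\<in>U. \<Prod>i\<in>X. ch i u) = (if X = {} then of_nat k ^ card P else 0)"
    if X: "X \<in> Pow I" for X
  proof -
    \<comment> \<open>The sum over \<open>U\<close> factors into one orthogonality sum per
      coordinate \<open>q\<close>; by \<open>contra\<close> some factor vanishes unless
      \<open>X\<close> is empty.\<close>
    have "(\<Prod>i\<in>X. ch i u) = (\<Prod>q\<in>P. w ^ (u q * (\<Sum>i\<in>X. v i q)))" for u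
      unfolding ch_def power_sum[symmetric] sum_distrib_left
      by (subst sum.swap) simp
    then have "(\<Sum>u\<in>U. \<Prod>i\<in>X. ch i u) = (\<Prod>q\<in>P. \<Sum>j<k. w ^ (j * (\<Sum>i\<in>X. v i q)))"
      unfolding U_def by (subst prod_sum_PiE) (use fin in auto)
    also have "\<dots> = (\<Prod>q\<in>P. if k dvd (\<Sum>i\<in>X. v i q) then of_nat k else 0)"
      unfolding w_def sum_root_of_unity_powers[OF k] ..
    also have "\<dots> = (if X = {} then of_nat k ^ card P else 0)"
    proof (cases "X = {}")
      case False
      then obtain q where "q \<in> P" "\<not> k dvd (\<Sum>i\<in>X. v i q)" using contra X by blast
      then show ?thesis using False fin by (auto intro!: prod_zero)
    qed simp
    finally show ?thesis .
  qed
  ultimately have "(\<Sum>X\<in>Pow I. (-1) ^ card X * (\<Prod>i\<in>I-X. \<alpha> i)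
      * (if X = {} then of_nat k ^ card P else 0)) = 0" by simp
  also have "(\<Sum>X\<in>Pow I. (-1) ^ card X * (\<Prod>i\<in>I-X. \<alpha> i)
      * (if X = {} then of_nat k ^ card P else 0))
    = (\<Sum>X\<in>{{}}. (-1) ^ card X * (\<Prod>i\<in>I-X. \<alpha> i) * of_nat k ^ card P)"
    using fin by (intro sum.mono_neutral_cong_right) auto
  finally have "\<exists>i\<in>I. \<alpha> i = 0" using k fin by simp
  then show False using \<alpha>(1) k by (metis power_0_left less_irrefl zero_neq_one)
qed

text \<open>Zero-sum subfamilies applied to exponent vectors modulo \<open>k\<close>, with
  \<open>R\<close> such that \<open>(1 - 1/k) ^ R < 1/k\<close>. A threshold linear in
  \<open>card P\<close> can be compared with prime counts.\<close>

lemma kth_power_subproduct: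
  fixes f :: "nat \<Rightarrow> nat" and k :: nat
  assumes "k \<ge> 2"
  shows "\<exists>R>0. \<forall>P I. finite P \<longrightarrow> finite I \<longrightarrow> R * card P < card I \<longrightarrow>
    (\<forall>i\<in>I. f i > 0 \<and> prime_factors (f i) \<subseteq> P) \<longrightarrow>
    (\<exists>S\<subseteq>I. S \<noteq> {} \<and> is_nth_power k (\<Prod>i\<in>S. f i))"
proof -
  define c where "c = 1 - 1 / real k"
  have c: "0 < c" "c < 1" using assms by (auto simp: c_def field_simps)
  obtain R where R: "c ^ R < 1 / real k"
    using real_arch_pow_inv[of "1 / real k" c] c assms by auto
  have "R > 0" using R assms by (cases R) (auto simp: field_simps)
  moreover have "\<exists>S\<subseteq>I. S \<noteq> {} \<and> is_nth_power k (\<Prod>i\<in>S. f i)"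
    if fin: "finite P" "finite I" and card: "R * card P < card I"
      and f: "\<forall>i\<in>I. f i > 0 \<and> prime_factors (f i) \<subseteq> P" for P I
  proof -
    \<comment> \<open>Each prime of \<open>P\<close> is paid for by \<open>R\<close> members of
      \<open>I\<close>. At least one member is left over, which makes the final inequality strict
      even for empty \<open>P\<close>.\<close>
    have "real k ^ card P * c ^ card I = (real k * c ^ R) ^ card P * c ^ (card I - R * card P)"
      using card by (simp add: power_mult_distrib flip: power_mult power_add mult.assoc)
    also have "\<dots> \<le> 1 * c ^ (card I - R * card P)"
      using R c assms by (intro mult_right_mono power_le_one) (auto simp: field_simps)
    also have "\<dots> < 1" using c card by (auto simp: power_less_one_iff)
    finally have "real k ^ card P * c ^ card I < 1" .
    with zero_sum_subfamily[of P I k "\<lambda>i q. multiplicity q (f i)"] fin assms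
    obtain S where S: "S \<subseteq> I" "S \<noteq> {}" "\<forall>q\<in>P. k dvd (\<Sum>i\<in>S. multiplicity q (f i))"
      unfolding c_def by auto
    have "k dvd multiplicity q (\<Prod>i\<in>S. f i)" if q: "prime q" for q
    proof -
      have "finite S" using S(1) fin finite_subset by blast
      moreover have "f i \<noteq> 0" if "i \<in> S" for i using S(1) f that by (metis in_mono less_irrefl)
      ultimately have "finite S" "0 \<notin> f ` S" by force+
      then have "multiplicity q (\<Prod>i\<in>S. f i) = (\<Sum>i\<in>S. multiplicity q (f i))"
        using q by (intro prime_elem_multiplicity_prod_distrib) auto
      also have "k dvd \<dots>"
      proof (cases "q \<in> P")
        case False
        then have "multiplicity q (f i) = 0" if "i \<in> S" for i
          using f S that q by (metis in_mono in_prime_factors_iff not_dvd_imp_multiplicity_0 not_gr_zero)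
        then show ?thesis by simp
      qed (use S in blast)
      finally show ?thesis .
    qed
    then show ?thesis using S assms by (auto simp: is_nth_power_conv_multiplicity_nat)
  qed
  ultimately show ?thesis by blast
qed

section \<open>Chebyshev bounds\<close>

text \<open>The entries of Leibniz' harmonic triangle are integer combinations of \<open>1/i\<close>
  with \<open>i \<le> n + 1\<close>, so \<open>M\<close> clears their denominators. This forces
  common multiples to be large.\<close>

lemma Suc_times_binomial_dvd:
  assumes "\<And>i. 1 \<le> i \<Longrightarrow> i \<le> Suc n \<Longrightarrow> i dvd M" and "k \<le> n"
  shows "Suc n * (n choose k) dvd M"
  using assms
proof (induction k arbitrary: n)
  case 0
  then show ?case by simp
next
  case (Suc k)
  then obtain m where n: "n = Suc m" by (cases n) auto
  have 1: "Suc m * (m choose k) dvd M"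
    using Suc.prems by (intro Suc.IH) (auto simp: n)
  have 2: "Suc n * (n choose k) dvd M"
    using Suc.prems by (intro Suc.IH) auto
  from 1 2 obtain u v where u: "M = Suc m * (m choose k) * u" and v: "M = Suc n * (n choose k) * v"
    unfolding dvd_def by blast
  \<comment> \<open>the recurrence of Leibniz' harmonic triangle, \<open>1 / ((n+1) C(n,k+1)) = 1 / (n C(n-1,k)) - 1 / ((n+1) C(n,k))\<close>\<close>
  have "int M = int (Suc n * (n choose Suc k)) * (int u - int v)"
  proof -
    have a1: "Suc k * (n choose Suc k) = n * (m choose k)"
      unfolding n by (rule Suc_times_binomial)
    have a2: "Suc k * (n choose Suc k) = (n - k) * (n choose k)"
      by (simp only: binomial_absorb_comp binomial_absorption)
    define x where "x = real (n choose Suc k)"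
    have r1: "real n * real (m choose k) = real (Suc k) * x"
      using arg_cong[OF a1, of real] unfolding x_def of_nat_mult by simp
    have r2: "(real n - real k) * real (n choose k) = real (Suc k) * x"
      using arg_cong[OF a2, of real] Suc.prems unfolding x_def of_nat_mult by (simp add: of_nat_diff)
    have u': "real M = real (Suc k) * x * real u"
      using r1 arg_cong[OF u, of real] unfolding n of_nat_mult by simp
    have v': "(real n - real k) * real M = real (Suc n) * real (Suc k) * x * real v"
      using r2 arg_cong[OF v, of real] unfolding of_nat_mult by (simp only: mult_ac)
    have "real (Suc k) * (real (Suc n) * x * (real u - real v)) = real (Suc n) * real M - (real n - real k) * real M"
    proof -
      have "real (Suc k) * (real (Suc n) * x * (real u - real v))
          = real (Suc n) * (real (Suc k) * x * real u) - real (Suc n) * real (Suc k) * x * real v"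
        by (simp only: right_diff_distrib mult_ac)
      then show ?thesis by (simp only: u'[symmetric] v'[symmetric])
    qed
    also have "\<dots> = real (Suc k) * real M" by (simp add: algebra_simps)
    finally have "real M = real (Suc n) * x * (real u - real v)" by simp
    then have "real_of_int (int M) = real_of_int (int (Suc n * (n choose Suc k)) * (int u - int v))"
      by (simp only: x_def of_int_mult of_int_diff of_int_of_nat_eq of_nat_mult)
    then show ?thesis by (simp only: of_int_eq_iff)
  qed
  then have "int (Suc n * (n choose Suc k)) dvd int M" by (metis dvd_triv_left)
  then show ?case by (simp only: int_dvd_int_iff)
qed

definition prime_count :: "nat \<Rightarrow> nat" where
  "prime_count x = card {p. prime p \<and> p \<le> x}"

lemma finite_primes_le [simp, intro]: "finite {p::nat. prime p \<and> p \<le> x}"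
  by (rule finite_subset[of _ "{..x}"]) auto

text \<open>The multiple is lcm(1, ..., N), the product over all primes up to \<open>N\<close> of
  the largest power not exceeding \<open>N\<close>; each factor is at most \<open>N\<close>.\<close>

lemma common_multiple_le:
  "\<exists>M>0. (\<forall>i. 1 \<le> i \<longrightarrow> i \<le> N \<longrightarrow> i dvd M) \<and> M \<le> N ^ prime_count N"
proof (cases "N = 0")
  case True
  have "{p::nat. prime p \<and> p \<le> 0} = {}" by auto
  then have "prime_count 0 = 0" by (simp only: prime_count_def card.empty)
  then show ?thesis using True by (auto intro!: exI[of _ 1])
next
  case False
  define P where "P = {p. prime p \<and> p \<le> N}"
  \<comment> \<open>The maximum exists for \<open>N > 0\<close>: the exponent 0 qualifies, and
    \<open>p \<ge> 2\<close> keeps every admissible exponent at most \<open>N\<close>.\<close>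
  define e where "e p = (GREATEST e. p ^ e \<le> N)" for p
  define M where "M = (\<Prod>p\<in>P. p ^ e p)"
  have finP: "finite P" by (simp add: P_def)
  have e: "p ^ e p \<le> N \<and> (\<forall>m. p ^ m \<le> N \<longrightarrow> m \<le> e p)" if "p \<in> P" for p
  proof -
    have "2 \<le> p" using that by (simp add: P_def prime_ge_2_nat)
    then have "m \<le> N" if m: "p ^ m \<le> N" for m
      using m less_exp[of m] power_mono[of 2 p m] by linarith
    then show ?thesis using False unfolding e_def
      by (intro conjI allI impI GreatestI_nat[of "\<lambda>e. p ^ e \<le> N" 0 N] Greatest_le_nat[of "\<lambda>e. p ^ e \<le> N" _ N]) auto
  qed
  have "i dvd M" if i: "1 \<le> i" "i \<le> N" for i
  proof (rule multiplicity_le_imp_dvd)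
    show "i \<noteq> 0" using i by simp
    fix p :: nat assume p: "prime p"
    have dv: "p ^ multiplicity p i dvd i" by (rule multiplicity_dvd)
    show "multiplicity p i \<le> multiplicity p M"
    proof (cases "p \<in> P")
      case True
      have "multiplicity p i \<le> e p" using e[OF True] i dvd_imp_le[OF dv] by simp
      moreover have "p ^ e p dvd M" unfolding M_def using True finP by (intro dvd_prodI) auto
      moreover have "M \<noteq> 0" unfolding M_def P_def by (auto simp: prime_gt_0_nat)
      ultimately show ?thesis using p
        by (meson multiplicity_geI le_trans not_prime_unit)
    next
      case False
      then have "\<not> p dvd i" using i p dvd_imp_le[of p i] unfolding P_def by auto
      then show ?thesis by (simp add: not_dvd_imp_multiplicity_0)
    qed
  qed
  moreover have "M \<le> (\<Prod>p\<in>P. N)" unfolding M_def using e by (intro prod_mono) auto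
  moreover have "M > 0" unfolding M_def P_def by (auto intro!: prod_pos simp: prime_gt_0_nat)
  ultimately show ?thesis using finP by (intro exI[of _ M]) (auto simp: prime_count_def P_def)
qed

text \<open>Chebyshev's lower bound. With \<open>2 * n = 2 ^ N\<close>, a positive common multiple
  of 1, ..., 2n is at least \<open>4 ^ n / 2\<close>, while \<open>common_multiple_le\<close>
  supplies one of size at most \<open>2 ^ (N * prime_count (2 ^ N))\<close>. At powers of 2 the
  logarithms are integer exponents.\<close>

lemma prime_count_pow2_ge:
  assumes "N > 0"
  shows "real N * real (prime_count (2 ^ N)) \<ge> 2 ^ N - 1"
proof -
  define n where "n = (2::nat) ^ (N - 1)"
  have n: "2 * n = 2 ^ N" "n > 0" using assms unfolding n_def by (cases N; simp)+
  obtain M where M: "M > 0" "\<And>i. 1 \<le> i \<Longrightarrow> i \<le> 2 * n \<Longrightarrow> i dvd M" "M \<le> (2 * n) ^ prime_count (2 * n)"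
    using common_multiple_le[of "2 * n"] by blast
  have "real (4 ^ n) \<le> real (2 * n) * real (2 * n choose n)"
    using central_binomial_lower_bound[OF n(2)] n(2) by (simp add: field_simps)
  also have "real (2 * n choose n) = 2 * real ((2 * n - 1) choose (n - 1))"
    using times_binomial_minus1_eq[of n "2 * n"] n(2) by (simp flip: of_nat_mult)
  also have "real (2 * n) * (2 * real ((2 * n - 1) choose (n - 1))) = 2 * real (2 * n * ((2 * n - 1) choose (n - 1)))"
    by simp
  also have "2 * n * ((2 * n - 1) choose (n - 1)) \<le> M"
    using Suc_times_binomial_dvd[of "2 * n - 1" M "n - 1"] M n(2) by (intro dvd_imp_le) auto
  then have "2 * real (2 * n * ((2 * n - 1) choose (n - 1))) \<le> 2 * real M"
    by (simp only: of_nat_le_iff mult_le_cancel_left_pos zero_less_numeral)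
  also have "real M \<le> real ((2 ^ N) ^ prime_count (2 ^ N))" using M(3) unfolding n(1) of_nat_le_iff .
  finally have "2 ^ (2 * n) \<le> (2::real) ^ Suc (N * prime_count (2 ^ N))"
    by (simp add: power_mult)
  then have "2 * n \<le> Suc (N * prime_count (2 ^ N))" by (rule power_le_imp_le_exp[rotated]) simp
  then have "2 ^ N \<le> Suc (N * prime_count (2 ^ N))" unfolding n(1) .
  then have "real (2 ^ N) \<le> real (Suc (N * prime_count (2 ^ N)))" by (simp only: of_nat_le_iff)
  then show ?thesis by simp
qed

section \<open>Upper bounds for prime counts and for sums of reciprocals of primes\<close>

lemma prod_primes_dvd_binomial:
  "(\<Prod>p | prime p \<and> n < p \<and> p \<le> 2 * n. p) dvd (2 * n choose n)"
proof -
  have "p dvd (2 * n choose n)" if p: "prime p" "n < p" "p \<le> 2 * n" for p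
  proof -
    have "p dvd fact (2 * n)" using p by (simp add: prime_dvd_fact_iff)
    also have "fact (2 * n) = fact n * fact n * (2 * n choose n)"
      using binomial_fact_lemma[of n "2 * n"] by (simp add: mult_2)
    finally show ?thesis using p by (simp add: prime_dvd_mult_iff prime_dvd_fact_iff)
  qed
  then show ?thesis
    using coprime_cong_prod_nat[of "{p. prime p \<and> n < p \<and> p \<le> 2 * n}" "\<lambda>p. p" "2 * n choose n" 0]
    by (auto simp: cong_0_iff intro: primes_coprime)
qed

text \<open>The product of these primes divides a central binomial coefficient of size at most
  \<open>2 ^ (2 ^ Suc j)\<close>, and each of them exceeds \<open>2 ^ j\<close>.\<close>

lemma card_primes_dyadic:
  assumes "j > 0"
  shows "j * card {p::nat. prime p \<and> 2 ^ j < p \<and> p \<le> 2 ^ Suc j} \<le> 2 ^ Suc j"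
proof -
  define A where "A = {p::nat. prime p \<and> 2 ^ j < p \<and> p \<le> 2 ^ Suc j}"
  have fin: "finite A" unfolding A_def by (rule finite_subset[of _ "{..2 ^ Suc j}"]) auto
  have "2 ^ (j * card A) = (\<Prod>p\<in>A. 2 ^ j)" by (simp add: power_mult)
  also have "\<dots> \<le> (\<Prod>p\<in>A. p)" by (intro prod_mono) (auto simp: A_def)
  also have "\<dots> \<le> (2 * 2 ^ j choose 2 ^ j)"
    using prod_primes_dvd_binomial[of "2 ^ j"] unfolding A_def by (intro dvd_imp_le) auto
  also have "\<dots> \<le> 2 ^ (2 * 2 ^ j)" by (rule binomial_le_pow2)
  finally show ?thesis unfolding A_def by simp
qed

text \<open>Induction over dyadic blocks: the old bound and the new block give
  \<open>8 * 2 ^ N\<close> with the factor \<open>N\<close>. Raising that factor to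
  \<open>Suc N\<close> costs at most 3/2 once \<open>N \<ge> 2\<close>, which yields
  \<open>6 * 2 ^ Suc N\<close>.\<close>

lemma prime_count_pow2_le:
  assumes "N > 0"
  shows "N * prime_count (2 ^ N) \<le> 6 * 2 ^ N"
  using assms
proof (induction N rule: nat_induct_non_zero)
  case 1
  have "{p::nat. prime p \<and> p \<le> 2} \<subseteq> {..2}" by auto
  then have "prime_count 2 \<le> 3" unfolding prime_count_def using card_mono[of "{..2::nat}"] by fastforce
  then show ?case by simp
next
  case (Suc N)
  have split: "{p. prime p \<and> p \<le> 2 ^ Suc N} = {p. prime p \<and> p \<le> 2 ^ N} \<union> {p::nat. prime p \<and> 2 ^ N < p \<and> p \<le> 2 ^ Suc N}"
    by auto
  have c: "prime_count (2 ^ Suc N) \<le> prime_count (2 ^ N) + card {p::nat. prime p \<and> 2 ^ N < p \<and> p \<le> 2 ^ Suc N}"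
    unfolding prime_count_def split by (rule card_Un_le)
  have "N * prime_count (2 ^ Suc N) \<le> N * prime_count (2 ^ N) + N * card {p::nat. prime p \<and> 2 ^ N < p \<and> p \<le> 2 ^ Suc N}"
    using mult_le_mono2[OF c, of N] by (simp add: algebra_simps)
  also have "\<dots> \<le> 8 * 2 ^ N" using Suc.IH card_primes_dyadic[OF Suc.hyps] by simp
  finally have *: "N * prime_count (2 ^ Suc N) \<le> 8 * 2 ^ N" .
  show ?case
  proof (cases "N = 1")
    case True
    have "{p::nat. prime p \<and> p \<le> 4} \<subseteq> {..4}" by auto
    then have "prime_count 4 \<le> 5" unfolding prime_count_def using card_mono[of "{..4::nat}"] by fastforce
    with True show ?thesis by simp
  next
    case False
    then have "2 * (Suc N * prime_count (2 ^ Suc N)) \<le> 3 * (N * prime_count (2 ^ Suc N))"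
      using Suc.hyps by (simp add: algebra_simps)
    also have "\<dots> \<le> 3 * (8 * 2 ^ N)" using * by simp
    finally show ?thesis by simp
  qed
qed

text \<open>For \<open>J > 0\<close> the block above \<open>2 ^ J\<close> contributes at most
  \<open>2 / J \<le> 4 / Suc J\<close>, hence the harmonic number: the sum of 1/p up to x is O(log
  log x).\<close>

lemma sum_inverse_primes_pow2_le:
  "(\<Sum>p | prime p \<and> p \<le> 2 ^ J. 1 / real p) \<le> 4 * harm J"
proof (induction J)
  case 0
  have "{p::nat. prime p \<and> p \<le> 1} = {}" by (auto dest: prime_gt_1_nat)
  then show ?case unfolding power_0 by (simp only: sum.empty harm_expand)
next
  case (Suc J)
  define A where "A = {p::nat. prime p \<and> 2 ^ J < p \<and> p \<le> 2 ^ Suc J}"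
  have fin: "finite A" unfolding A_def by (rule finite_subset[of _ "{..2 ^ Suc J}"]) auto
  have split: "{p. prime p \<and> p \<le> 2 ^ Suc J} = {p. prime p \<and> p \<le> 2 ^ J} \<union> A"
    unfolding A_def by auto
  have eq: "(\<Sum>p | prime p \<and> p \<le> 2 ^ Suc J. 1 / real p) = (\<Sum>p | prime p \<and> p \<le> 2 ^ J. 1 / real p) + (\<Sum>p\<in>A. 1 / real p)"
    unfolding split using fin by (intro sum.union_disjoint) (auto simp: A_def)
  have "(\<Sum>p\<in>A. 1 / real p) \<le> real (card A) * (1 / 2 ^ J)"
    by (intro sum_bounded_above) (auto simp: A_def field_simps)
  also have "real (card A) * (1 / 2 ^ J) \<le> 4 / real (Suc J)"
  proof (cases "J = 0")
    case True
    have "A \<subseteq> {2}" unfolding A_def True by auto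
    then have "card A \<le> 1" using card_mono[of "{2::nat}" A] by simp
    then show ?thesis using True by simp
  next
    case False
    have "real (J * card A) \<le> real (2 ^ Suc J)"
      using card_primes_dyadic[of J] False unfolding A_def of_nat_le_iff by simp
    then have "real (card A) * (1 / 2 ^ J) \<le> 2 / real J" using False by (simp add: field_simps)
    also have "\<dots> \<le> 4 / real (Suc J)" using False by (simp add: field_simps)
    finally show ?thesis .
  qed
  finally show ?case using Suc.IH unfolding eq harm_Suc by (simp add: inverse_eq_divide distrib_left)
qed

section \<open>Brun's pure sieve\<close>

lemma card_residue_class:
  fixes D y X :: nat
  assumes "y < D"
  shows "card {n. n < X \<and> n mod D = y} = (X + (D - 1 - y)) div D"
proof (induction X)
  case 0
  then show ?case using assms by simp
next
  case (Suc X)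
  have iff: "Suc (X + (D - 1 - y)) mod D = 0 \<longleftrightarrow> X mod D = y"
  proof -
    have "Suc (X + (D - 1 - y)) = X + (D - y)" "y + (D - y) = D" using assms by auto
    then have "Suc (X + (D - 1 - y)) mod D = 0 \<longleftrightarrow> [X + (D - y) = y + (D - y)] (mod D)"
      by (simp only: Cong.cong_def mod_self)
    also have "\<dots> \<longleftrightarrow> [X = y] (mod D)" by (rule cong_add_rcancel_nat)
    finally show ?thesis using assms by (simp add: Cong.cong_def)
  qed
  have "{n. n < Suc X \<and> n mod D = y} = {n. n < X \<and> n mod D = y} \<union> (if X mod D = y then {X} else {})"
    by (auto simp: less_Suc_eq)
  then have "card {n. n < Suc X \<and> n mod D = y} = card {n. n < X \<and> n mod D = y} + (if X mod D = y then 1 else 0)"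
    by simp
  also have "\<dots> = Suc (X + (D - 1 - y)) div D"
    unfolding Suc.IH div_Suc iff by simp
  finally show ?case by simp
qed

lemma card_residue_class_approx:
  fixes D y X :: nat
  assumes "y < D"
  shows "\<bar>real (card {n. n < X \<and> n mod D = y}) - real X / real D\<bar> \<le> 1"
proof -
  define q where "q = (X + (D - 1 - y)) div D"
  have 1: "q * D \<le> X + (D - 1 - y)" unfolding q_def by simp
  have "X + (D - 1 - y) < q * D + D" unfolding q_def
    using assms by (metis add.commute dividend_less_div_times le_less_trans zero_le)
  then have "X \<le> (q + 1) * D" "q * D \<le> X + D" using 1 by auto
  then have "real X \<le> real ((q + 1) * D)" "real (q * D) \<le> real (X + D)"
    unfolding of_nat_le_iff .
  then have "real X \<le> (real q + 1) * real D" "real q * real D \<le> real X + real D"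
    by (simp_all add: algebra_simps)
  then show ?thesis using assms unfolding card_residue_class[OF assms] q_def[symmetric]
    by (auto simp: abs_le_iff field_simps)
qed

text \<open>By the Chinese remainder theorem the conditions amount to one residue class modulo
  \<open>\<Prod>T\<close>.\<close>

lemma card_residue_system_approx:
  fixes T :: "nat set" and f :: "nat \<Rightarrow> nat"
  assumes "finite T" "\<And>p. p \<in> T \<Longrightarrow> prime p" "\<And>p. p \<in> T \<Longrightarrow> f p < p"
  shows "\<bar>real (card {n. n < X \<and> (\<forall>p\<in>T. n mod p = f p)}) - real X / (\<Prod>p\<in>T. real p)\<bar> \<le> 1"
proof -
  have cop: "coprime i j" if "i \<in> T" "j \<in> T" "i \<noteq> j" for i j
    using assms that by (intro primes_coprime) auto
  have nz: "\<forall>p\<in>T. p \<noteq> 0" using assms(3) by force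
  have "\<exists>!y. y < \<Prod>T \<and> (\<forall>p\<in>T. [y = f p] (mod p))"
    using assms(1) nz cop by (intro chinese_remainder_unique_nat) auto
  then obtain y where y: "y < \<Prod>T" "\<forall>p\<in>T. [y = f p] (mod p)" by (elim ex1E conjE)
  have "(\<forall>p\<in>T. n mod p = f p) \<longleftrightarrow> n mod \<Prod>T = y" for n
  proof
    assume "\<forall>p\<in>T. n mod p = f p"
    then have "[n = y] (mod p)" if "p \<in> T" for p
      using y(2) assms(3) that by (auto simp: Cong.cong_def)
    then have "[n = y] (mod \<Prod>T)" using cop by (intro coprime_cong_prod_nat) auto
    then show "n mod \<Prod>T = y" using y(1) by (simp add: Cong.cong_def)
  next
    assume *: "n mod \<Prod>T = y"
    show "\<forall>p\<in>T. n mod p = f p"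
    proof
      fix p assume p: "p \<in> T"
      have "[n = y] (mod \<Prod>T)" using * by (auto simp: Cong.cong_def)
      then have "[n = y] (mod p)" by (rule cong_dvd_modulus_nat) (use p assms in \<open>auto intro: dvd_prodI\<close>)
      then show "n mod p = f p" using y(2) p assms(3)[OF p] by (auto simp: Cong.cong_def)
    qed
  qed
  then show ?thesis using card_residue_class_approx[OF y(1), of X] by (simp add: of_nat_prod)
qed

text \<open>There are \<open>\<kappa> ^ card T\<close> ways to choose one residue from each
  \<open>\<Omega> p\<close>, and every choice contributes an error of at most 1.\<close>

lemma card_sifted_approx:
  fixes T :: "nat set" and \<Omega> :: "nat \<Rightarrow> nat set"
  assumes fin: "finite T" and T: "\<And>p. p \<in> T \<Longrightarrow> prime p"
    and \<Omega>: "\<And>p. p \<in> T \<Longrightarrow> \<Omega> p \<subseteq> {..<p}" "\<And>p. p \<in> T \<Longrightarrow> card (\<Omega> p) = \<kappa>"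
  shows "\<bar>real (card {n. n < X \<and> (\<forall>p\<in>T. n mod p \<in> \<Omega> p)}) - real X * (\<Prod>p\<in>T. real \<kappa> / real p)\<bar> \<le> real \<kappa> ^ card T"
proof -
  let ?F = "PiE T \<Omega>"
  define N where "N f = {n. n < X \<and> (\<forall>p\<in>T. n mod p = f p)}" for f :: "nat \<Rightarrow> nat"
  have fin\<Omega>: "finite (\<Omega> p)" if "p \<in> T" for p using \<Omega>(1)[OF that] finite_subset by blast
  have finF: "finite ?F" using fin fin\<Omega> by (intro finite_PiE) auto
  have cardF: "card ?F = \<kappa> ^ card T" using fin \<Omega>(2) by (simp add: card_PiE)
  have "{n. n < X \<and> (\<forall>p\<in>T. n mod p \<in> \<Omega> p)} = (\<Union>f\<in>?F. N f)"
  proof (intro equalityI subsetI)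
    fix n assume n: "n \<in> {n. n < X \<and> (\<forall>p\<in>T. n mod p \<in> \<Omega> p)}"
    then have "(\<lambda>p\<in>T. n mod p) \<in> ?F" "n \<in> N (\<lambda>p\<in>T. n mod p)" by (auto simp: N_def)
    then show "n \<in> (\<Union>f\<in>?F. N f)" by blast
  qed (auto simp: N_def PiE_mem)
  also have "card \<dots> = (\<Sum>f\<in>?F. card (N f))"
  proof (intro card_UN_disjoint finF ballI impI)
    fix f g assume fg: "f \<in> ?F" "g \<in> ?F" "f \<noteq> g"
    then obtain p where "p \<in> T" "f p \<noteq> g p" by (metis PiE_ext)
    then show "N f \<inter> N g = {}" by (auto simp: N_def)
  qed (auto simp: N_def)
  finally have "real (card {n. n < X \<and> (\<forall>p\<in>T. n mod p \<in> \<Omega> p)}) - real X * (\<Prod>p\<in>T. real \<kappa> / real p)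
      = (\<Sum>f\<in>?F. real (card (N f)) - real X / (\<Prod>p\<in>T. real p))"
    using cardF by (simp add: sum_subtractf prod_dividef)
  also have "\<bar>\<dots>\<bar> \<le> (\<Sum>f\<in>?F. \<bar>real (card (N f)) - real X / (\<Prod>p\<in>T. real p)\<bar>)" by (rule sum_abs)
  also have "\<dots> \<le> (\<Sum>f\<in>?F. 1)"
  proof (rule sum_mono)
    fix f assume f: "f \<in> ?F"
    then have "f p < p" if "p \<in> T" for p using \<Omega>(1)[OF that] that by (auto simp: PiE_def Pi_def)
    then show "\<bar>real (card (N f)) - real X / (\<Prod>p\<in>T. real p)\<bar> \<le> 1"
      unfolding N_def using T fin by (intro card_residue_system_approx) auto
  qed
  finally show ?thesis using cardF by simp
qed

text \<open>For nonempty \<open>A\<close>, cutting the alternating sum after an even index leaves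
  \<open>(card A - 1) choose (2 * r)\<close>, which is not negative. An even cut therefore gives an
  upper sieve.\<close>

lemma bonferroni_truncated:
  fixes A :: "'a set"
  assumes "finite A"
  shows "(if A = {} then 1 else 0) \<le> (\<Sum>T | T \<subseteq> A \<and> card T \<le> 2 * r. (-1) ^ card T :: real)"
proof (cases "A = {}")
  case True
  then have "{T. T \<subseteq> A \<and> card T \<le> 2 * r} = {{}}" by auto
  then show ?thesis using True by simp
next
  case False
  have "(\<Sum>T | T \<subseteq> A \<and> card T \<le> m. (-1) ^ card T :: real) = (\<Sum>j\<le>m. (-1) ^ j * real (card A choose j))" for m
  proof -
    have "{T. T \<subseteq> A \<and> card T \<le> m} = (\<Union>j\<in>{..m}. {T. T \<subseteq> A \<and> card T = j})" by auto
    then have "(\<Sum>T | T \<subseteq> A \<and> card T \<le> m. (-1) ^ card T :: real) = (\<Sum>j\<le>m. \<Sum>T | T \<subseteq> A \<and> card T = j. (-1) ^ card T)"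
      using assms by (simp only:) (intro sum.UNION_disjoint, auto)
    also have "\<dots> = (\<Sum>j\<le>m. (-1) ^ j * real (card A choose j))"
      using assms by (intro sum.cong) (simp_all add: n_subsets)
    finally show ?thesis .
  qed
  also have "(\<Sum>j\<le>2 * r. (-1) ^ j * real (card A choose j)) = (real (card A) - 1) gchoose (2 * r)"
    using gbinomial_sum_lower_neg[of "real (card A)" "2 * r"] by (simp add: binomial_gbinomial mult.commute)
  also have "(if A = {} then 1 else 0) \<le> \<dots>"
  proof -
    have "real (card A) - 1 = real (card A - 1)" using assms False by (simp add: of_nat_diff card_gt_0_iff Suc_leI)
    then have "(real (card A) - 1) gchoose (2 * r) = real ((card A - 1) choose (2 * r))"
      by (simp only: binomial_gbinomial)
    then show ?thesis using False by simp
  qed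
  finally show ?thesis .
qed

text \<open>Inclusion-exclusion cut at level \<open>2 * r\<close>. The three terms are the full
  product, the cost of completing the cut sum to that product, and the rounding errors
  \<open>2 ^ card T\<close> of the sets kept.\<close>

lemma brun_sieve:
  fixes P :: "nat set" and \<Omega> :: "nat \<Rightarrow> nat set"
  assumes fin: "finite P" and P: "\<And>p. p \<in> P \<Longrightarrow> prime p"
    and \<Omega>: "\<And>p. p \<in> P \<Longrightarrow> \<Omega> p \<subseteq> {..<p}" "\<And>p. p \<in> P \<Longrightarrow> card (\<Omega> p) = 2"
    and Z: "real (card P) \<le> Z" "1 \<le> Z"
  shows "real (card {n. n < X \<and> (\<forall>p\<in>P. n mod p \<notin> \<Omega> p)})
    \<le> real X * ((\<Prod>p\<in>P. 1 - 2 / real p) + (1 / 4) ^ r * exp (4 * (\<Sum>p\<in>P. 1 / real p))) + Z ^ (2 * r) * exp 2"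
proof -
  define L where "L = {T. T \<subseteq> P \<and> card T \<le> 2 * r}"
  define H where "H = {T. T \<subseteq> P \<and> 2 * r < card T}"
  have LH: "finite L" "finite H" "L \<inter> H = {}" "L \<union> H = Pow P"
    using fin by (auto simp: L_def H_def)
  define N where "N T = {n. n < X \<and> (\<forall>p\<in>T. n mod p \<in> \<Omega> p)}" for T
  define g where "g T = (\<Prod>p\<in>T. 2 / real p)" for T :: "nat set"
  have g0: "g T \<ge> 0" for T by (auto simp: g_def intro: prod_nonneg)
  define A where "A n = {p\<in>P. n mod p \<in> \<Omega> p}" for n
  have "real (card {n. n < X \<and> (\<forall>p\<in>P. n mod p \<notin> \<Omega> p)}) = (\<Sum>n<X. if A n = {} then 1 else 0)"
  proof -
    have "{n. n < X \<and> (\<forall>p\<in>P. n mod p \<notin> \<Omega> p)} = {n\<in>{..<X}. A n = {}}" by (auto simp: A_def)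
    then show ?thesis by (simp add: sum.If_cases Int_def)
  qed
  also have "\<dots> \<le> (\<Sum>n<X. \<Sum>T | T \<subseteq> A n \<and> card T \<le> 2 * r. (-1) ^ card T)"
    using fin by (intro sum_mono bonferroni_truncated) (auto simp: A_def)
  also have "\<dots> = (\<Sum>n<X. \<Sum>T\<in>L. if T \<subseteq> A n then (-1) ^ card T else 0)"
  proof (rule sum.cong[OF refl])
    fix n
    have "{T. T \<subseteq> A n \<and> card T \<le> 2 * r} = {T \<in> L. T \<subseteq> A n}" by (auto simp: L_def A_def)
    then show "(\<Sum>T | T \<subseteq> A n \<and> card T \<le> 2 * r. (-1) ^ card T) = (\<Sum>T\<in>L. if T \<subseteq> A n then (-1) ^ card T else (0::real))"
      using LH(1) by (simp add: sum.If_cases Int_def)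
  qed
  also have "\<dots> = (\<Sum>T\<in>L. \<Sum>n<X. if T \<subseteq> A n then (-1) ^ card T else 0)" by (rule sum.swap)
  also have "\<dots> = (\<Sum>T\<in>L. (-1) ^ card T * real (card (N T)))"
  proof (rule sum.cong[OF refl])
    fix T assume "T \<in> L"
    then have "N T = {n\<in>{..<X}. T \<subseteq> A n}" by (auto simp: N_def A_def L_def)
    then show "(\<Sum>n<X. if T \<subseteq> A n then (-1) ^ card T else (0::real)) = (-1) ^ card T * real (card (N T))"
      by (simp add: sum.If_cases Int_def mult.commute)
  qed
  also have "\<dots> \<le> (\<Sum>T\<in>L. (-1) ^ card T * (real X * g T) + 2 ^ card T)"
  proof (rule sum_mono)
    fix T assume T: "T \<in> L"
    have "\<bar>real (card (N T)) - real X * g T\<bar> \<le> real 2 ^ card T"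
      using card_sifted_approx[of T \<Omega> 2 X] T P \<Omega> finite_subset[OF _ fin, of T]
      unfolding N_def g_def L_def by (auto simp: subset_iff)
    then have "\<bar>(-1) ^ card T * (real (card (N T)) - real X * g T)\<bar> \<le> 2 ^ card T"
      by (simp add: abs_mult power_abs)
    then have "(-1) ^ card T * (real (card (N T)) - real X * g T) \<le> 2 ^ card T" by linarith
    then show "(-1) ^ card T * real (card (N T)) \<le> (-1) ^ card T * (real X * g T) + 2 ^ card T"
      by (simp add: right_diff_distrib)
  qed
  also have "\<dots> = real X * (\<Sum>T\<in>L. (-1) ^ card T * g T) + (\<Sum>T\<in>L. 2 ^ card T)"
    by (simp add: sum.distrib sum_distrib_left mult_ac)
  also have "(\<Sum>T\<in>L. (-1) ^ card T * g T) \<le> (\<Prod>p\<in>P. 1 - 2 / real p) + (1 / 4) ^ r * exp (4 * (\<Sum>p\<in>P. 1 / real p))"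
  proof -
    have "(\<Prod>p\<in>P. 1 - 2 / real p) = (\<Sum>T\<in>L \<union> H. (-1) ^ card T * g T)"
      unfolding LH(4) g_def using prod_diff_conv_sum[OF fin, of "\<lambda>_. 1" "\<lambda>p. 2 / real p"] by simp
    also have "\<dots> = (\<Sum>T\<in>L. (-1) ^ card T * g T) + (\<Sum>T\<in>H. (-1) ^ card T * g T)"
      using LH by (intro sum.union_disjoint) auto
    finally have e: "(\<Sum>T\<in>L. (-1) ^ card T * g T) = (\<Prod>p\<in>P. 1 - 2 / real p) - (\<Sum>T\<in>H. (-1) ^ card T * g T)"
      by simp
    \<comment> \<open>Rankin's trick: on \<open>H\<close> the weight
      \<open>2 ^ (card T - 2 * r)\<close> is at least 1, and it turns the tail into
      \<open>(1/4) ^ r\<close> times a full product over \<open>P\<close>.\<close>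
    have "- (\<Sum>T\<in>H. (-1) ^ card T * g T) \<le> (\<Sum>T\<in>H. (1 / 4) ^ r * (\<Prod>p\<in>T. 4 / real p))"
      unfolding sum_negf[symmetric]
    proof (rule sum_mono)
      fix T assume T: "T \<in> H"
      have "- ((-1) ^ card T * g T) \<le> g T" using g0[of T] by (cases "even (card T)") auto
      also have "\<dots> \<le> 2 ^ (card T - 2 * r) * g T" using g0[of T] mult_right_mono[of 1 "2 ^ (card T - 2 * r)" "g T"] by simp
      also have "\<dots> = (1 / 4) ^ r * (2 ^ card T * g T)"
        using T by (simp add: H_def power_diff power_mult power_divide)
      also have "2 ^ card T * g T = (\<Prod>p\<in>T. 4 / real p)"
        unfolding g_def by (simp flip: prod_constant prod.distrib)
      finally show "- ((-1) ^ card T * g T) \<le> (1 / 4) ^ r * (\<Prod>p\<in>T. 4 / real p)" .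
    qed
    also have "\<dots> \<le> (\<Sum>T\<in>Pow P. (1 / 4) ^ r * (\<Prod>p\<in>T. 4 / real p))"
      using fin LH by (intro sum_mono2) (auto intro!: prod_nonneg mult_nonneg_nonneg)
    also have "\<dots> = (1 / 4) ^ r * (\<Prod>p\<in>P. 4 / real p + 1)"
      unfolding prod_add[OF fin] by (simp add: sum_distrib_left)
    also have "(\<Prod>p\<in>P. 4 / real p + 1) \<le> (\<Prod>p\<in>P. exp (4 / real p))"
      by (intro prod_mono conjI) (auto simp: add.commute intro: exp_ge_add_one_self)
    also have "\<dots> = exp (4 * (\<Sum>p\<in>P. 1 / real p))"
      using fin by (simp add: exp_sum sum_distrib_left)
    finally show ?thesis using e by simp
  qed
  also have "(\<Sum>T\<in>L. 2 ^ card T) \<le> Z ^ (2 * r) * exp 2"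
  proof -
    \<comment> \<open>The same trick from the other side:
      \<open>Z ^ (2 * r - card T) \<ge> 1\<close> on \<open>L\<close>. The sum over all subsets is
      then a product, bounded through \<open>card P \<le> Z\<close>.\<close>
    have "(\<Sum>T\<in>L. 2 ^ card T) \<le> (\<Sum>T\<in>L. Z ^ (2 * r) * (\<Prod>p\<in>T. 2 / Z))"
    proof (rule sum_mono)
      fix T assume T: "T \<in> L"
      have "Z ^ (2 * r) * (\<Prod>p\<in>T. 2 / Z) = Z ^ (2 * r - card T) * 2 ^ card T"
        using T Z by (simp add: L_def power_diff power_divide)
      also have "\<dots> \<ge> 1 * 2 ^ card T" using Z by (intro mult_right_mono) auto
      finally show "2 ^ card T \<le> Z ^ (2 * r) * (\<Prod>p\<in>T. 2 / Z)" by simp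
    qed
    also have "\<dots> \<le> (\<Sum>T\<in>Pow P. Z ^ (2 * r) * (\<Prod>p\<in>T. 2 / Z))"
      using fin LH Z by (intro sum_mono2) (auto intro!: mult_nonneg_nonneg)
    also have "\<dots> = Z ^ (2 * r) * (\<Prod>p\<in>P. 2 / Z + 1)"
      unfolding prod_add[OF fin] by (simp add: sum_distrib_left)
    also have "(\<Prod>p\<in>P. 2 / Z + 1) \<le> (\<Prod>p\<in>P. exp (2 / Z))"
      using Z by (intro prod_mono conjI) (auto simp: add.commute intro: exp_ge_add_one_self)
    also have "\<dots> = exp (card P * (2 / Z))" by (simp flip: exp_of_nat_mult)
    also have "\<dots> \<le> exp 2" using Z by (simp add: field_simps)
    finally show ?thesis using Z by (simp add: mult_left_mono)
  qed
  finally show ?thesis by (simp add: mult_left_mono)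
qed

section \<open>Pairs of primes of the form q and mq - 1\<close>

text \<open>Euler product: every positive \<open>n \<le> N\<close> has its prime factors and
  exponents bounded by \<open>N\<close>, so the harmonic sum is at most a product of geometric sums.
  The factor \<open>1 - 1/p\<close> collapses each of these to a number below 1.\<close>

lemma sum_inverse_le_prod_primes:
  "(\<Sum>n=1..N. 1 / real n) * (\<Prod>p | prime p \<and> p \<le> N. 1 - 1 / real p) \<le> 1"
proof -
  define P where "P = {p. prime p \<and> p \<le> N}"
  have fin: "finite P" by (simp add: P_def)
  have p2: "2 \<le> p" if "p \<in> P" for p using that by (simp add: P_def prime_ge_2_nat)
  have p1: "0 \<le> 1 - 1 / real p" if "p \<in> P" for p using p2[OF that] by simp
  define F where "F = PiE P (\<lambda>_. {..N})"
  define \<Phi> where "\<Phi> n = (\<lambda>p\<in>P. multiplicity p n)" for n :: nat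
  have finF: "finite F" unfolding F_def using fin by (intro finite_PiE) auto
  have prod: "(\<Prod>p\<in>P. p ^ \<Phi> n p) = n" if n: "n \<in> {1..N}" for n
  proof -
    have "prime_factors n \<subseteq> P"
    proof
      fix p assume "p \<in> prime_factors n"
      then have "prime p" "p dvd n" by (auto simp: in_prime_factors_iff)
      then show "p \<in> P" using n dvd_imp_le[of p n] by (auto simp: P_def)
    qed
    then have "(\<Prod>p\<in>P. p ^ multiplicity p n) = (\<Prod>p\<in>prime_factors n. p ^ multiplicity p n)"
      using fin by (intro prod.mono_neutral_right)
        (auto simp: P_def prime_factors_multiplicity)
    also have "\<dots> = n" using n by (intro prime_factorization_nat[symmetric]) auto
    finally show ?thesis by (simp add: \<Phi>_def)
  qed
  have \<Phi>F: "\<Phi> n \<in> F" if n: "n \<in> {1..N}" for n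
  proof -
    have "multiplicity p n \<le> N" if p: "p \<in> P" for p
    proof -
      have "multiplicity p n < 2 ^ multiplicity p n" by (rule less_exp)
      also have "\<dots> \<le> p ^ multiplicity p n" using p2[OF p] by (intro power_mono) auto
      also have "\<dots> \<le> n" using n by (intro dvd_imp_le multiplicity_dvd) auto
      finally show ?thesis using n by simp
    qed
    then show ?thesis by (auto simp: \<Phi>_def F_def)
  qed
  have "inj_on \<Phi> {1..N}" by (rule inj_onI) (metis prod)
  then have "(\<Sum>g\<in>\<Phi> ` {1..N}. 1 / real (\<Prod>p\<in>P. p ^ g p)) = (\<Sum>n=1..N. 1 / real (\<Prod>p\<in>P. p ^ \<Phi> n p))"
    by (simp only: sum.reindex o_def)
  also have "\<dots> = (\<Sum>n=1..N. 1 / real n)" by (rule sum.cong) (simp_all only: prod)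
  finally have "(\<Sum>n=1..N. 1 / real n) = (\<Sum>g\<in>\<Phi> ` {1..N}. 1 / real (\<Prod>p\<in>P. p ^ g p))" ..
  also have "\<dots> \<le> (\<Sum>g\<in>F. 1 / real (\<Prod>p\<in>P. p ^ g p))"
    using finF \<Phi>F by (intro sum_mono2) (auto intro!: prod_nonneg)
  also have "\<dots> = (\<Sum>g\<in>F. \<Prod>p\<in>P. (1 / real p) ^ g p)"
    by (intro sum.cong) (simp_all add: prod_dividef power_divide)
  also have "\<dots> = (\<Prod>p\<in>P. \<Sum>e\<le>N. (1 / real p) ^ e)"
    unfolding F_def using fin by (intro prod_sum_PiE[symmetric]) auto
  finally have "(\<Sum>n=1..N. 1 / real n) * (\<Prod>p\<in>P. 1 - 1 / real p)
      \<le> (\<Prod>p\<in>P. \<Sum>e\<le>N. (1 / real p) ^ e) * (\<Prod>p\<in>P. 1 - 1 / real p)"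
    using p1 by (intro mult_right_mono prod_nonneg) auto
  also have "\<dots> = (\<Prod>p\<in>P. (1 - 1 / real p) * (\<Sum>e\<le>N. (1 / real p) ^ e))"
    by (simp add: prod.distrib)
  also have "\<dots> = (\<Prod>p\<in>P. 1 - (1 / real p) ^ Suc N)"
    by (intro prod.cong refl sum_gp_basic)
  also have "\<dots> \<le> 1"
    using p1 by (intro prod_le_1) (auto intro!: power_le_one simp flip: power_Suc simp del: of_nat_power)
  finally show ?thesis by (simp add: P_def)
qed

text \<open>\<open>1 - 2/p \<le> (1 - 1/p)^2\<close> reduces the claim to the Euler product, which
  decays like 1/J. The primes up to \<open>c\<close> are restored at the fixed cost
  \<open>Q\<close>.\<close>

lemma prod_primes_minus_two_le:
  fixes c :: nat
  assumes "c > 0"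
  shows "\<exists>K>0. \<forall>J>0. (\<Prod>p | prime (p::nat) \<and> c < p \<and> p \<le> 2 ^ J. 1 - 2 / real p) \<le> K / real J ^ 2"
proof -
  define Q where "Q = (\<Prod>p | prime p \<and> p \<le> c. 1 - 1 / real p)"
  have Q: "0 < Q" "Q \<le> 1" unfolding Q_def
  proof -
    have "1 / real p < 1" "1 / real p \<le> 1" if "prime p" for p
      using prime_gt_1_nat[OF that] by auto
    then show "0 < (\<Prod>p | prime p \<and> p \<le> c. 1 - 1 / real p)" "(\<Prod>p | prime p \<and> p \<le> c. 1 - 1 / real p) \<le> 1"
      by (intro prod_pos prod_le_1; auto)+
  qed
  have "(\<Prod>p | prime (p::nat) \<and> c < p \<and> p \<le> 2 ^ J. 1 - 2 / real p) \<le> (1 / (Q * ln 2)) ^ 2 / real J ^ 2"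
    if J: "J > 0" for J
  proof -
    define A where "A = {p::nat. prime p \<and> c < p \<and> p \<le> 2 ^ J}"
    define B where "B = {p::nat. prime p \<and> p \<le> 2 ^ J}"
    define V where "V = (\<Prod>p\<in>A. 1 - 1 / real p)"
    have AB: "A \<subseteq> B" "finite A" "finite B" unfolding A_def B_def by (auto intro: finite_subset[of _ "{..2 ^ J}"])
    have p2: "2 \<le> p" if "p \<in> B" for p using that by (simp add: B_def prime_ge_2_nat)
    have p1: "0 \<le> 1 - 1 / real p \<and> 1 - 1 / real p \<le> 1" if "prime p" for p
      using prime_ge_2_nat[OF that] by simp
    have V0: "0 \<le> V" unfolding V_def using p1 by (intro prod_nonneg) (auto simp: A_def)
    have "(\<Prod>p\<in>A. 1 - 2 / real p) \<le> (\<Prod>p\<in>A. (1 - 1 / real p) ^ 2)"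
      using p2 AB by (intro prod_mono) (force simp: power2_eq_square algebra_simps)
    also have "\<dots> = V ^ 2" by (simp add: V_def prod_power_distrib)
    finally have 1: "(\<Prod>p\<in>A. 1 - 2 / real p) \<le> V ^ 2" .
    have "Q * V \<le> (\<Prod>p\<in>B. 1 - 1 / real p)"
    proof -
      \<comment> \<open>\<open>B - A\<close> consists of the primes up to both \<open>c\<close> and
        \<open>2 ^ J\<close>; primes up to \<open>c\<close> missing from it only make
        \<open>Q\<close> smaller.\<close>
      have "Q \<le> (\<Prod>p\<in>B - A. 1 - 1 / real p)"
      proof -
        have "Q = (\<Prod>p\<in>B - A. 1 - 1 / real p) * (\<Prod>p\<in>{p. prime p \<and> p \<le> c} - (B - A). 1 - 1 / real p)"
          unfolding Q_def by (subst mult.commute, intro prod.subset_diff) (auto simp: A_def B_def)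
        also have "\<dots> \<le> (\<Prod>p\<in>B - A. 1 - 1 / real p) * 1"
          using p1 by (intro mult_left_mono prod_le_1 prod_nonneg) (simp_all add: B_def)
        finally show ?thesis by simp
      qed
      then have "Q * V \<le> (\<Prod>p\<in>B - A. 1 - 1 / real p) * V" using V0 by (rule mult_right_mono)
      also have "\<dots> = (\<Prod>p\<in>B. 1 - 1 / real p)" unfolding V_def using AB by (intro prod.subset_diff[symmetric]) auto
      finally show ?thesis .
    qed
    moreover have "real J * ln 2 \<le> harm (2 ^ J)"
    proof -
      have "real J * ln 2 = ln (2 ^ J)" by (simp add: ln_realpow)
      also have "\<dots> \<le> ln (real (2 ^ J) + 1)" by (intro ln_mono) auto
      also have "\<dots> \<le> harm (2 ^ J)" by (rule ln_le_harm)
      finally show ?thesis .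
    qed
    ultimately have "(real J * ln 2) * (Q * V) \<le> harm (2 ^ J) * (\<Prod>p\<in>B. 1 - 1 / real p)"
      using Q V0 by (intro mult_mono) (auto simp: harm_nonneg)
    also have "\<dots> \<le> 1"
      using sum_inverse_le_prod_primes[of "2 ^ J"] by (simp add: B_def harm_def inverse_eq_divide)
    finally have "V \<le> 1 / (Q * ln 2) / real J" using Q J by (simp add: field_simps)
    then have "V ^ 2 \<le> (1 / (Q * ln 2) / real J) ^ 2" using V0 by (intro power_mono) auto
    then show ?thesis using 1 unfolding A_def by (simp add: power_divide power_mult_distrib)
  qed
  moreover have "(1 / (Q * ln 2)) ^ 2 > 0" using Q by simp
  ultimately show ?thesis by blast
qed

text \<open>These are the residues of \<open>n\<close> for which \<open>p\<close> divides
  \<open>n\<close> or \<open>m * n - 1\<close>: 0 and the inverse of \<open>m\<close>, which is not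
  0.\<close>

lemma card_twin_residues:
  fixes m p :: nat
  assumes "prime p" "\<not> p dvd m"
  shows "card {a. a < p \<and> (a = 0 \<or> [m * a = 1] (mod p))} = 2"
proof -
  have "coprime m p" using assms by (metis coprime_commute prime_imp_coprime)
  then obtain x where x: "[m * x = 1] (mod p)" using cong_solve_coprime_nat by auto
  have p: "p > 1" using assms prime_gt_1_nat by blast
  have iff: "[m * a = 1] (mod p) \<longleftrightarrow> [a = x] (mod p)" for a
    using \<open>coprime m p\<close> x by (metis cong_mult_lcancel_nat cong_sym cong_trans)
  have "\<not> [0 = x] (mod p)" using iff[of 0] p by (auto simp: Cong.cong_def)
  then have "x mod p \<noteq> 0" by (auto simp: Cong.cong_def)
  moreover have "{a. a < p \<and> (a = 0 \<or> [m * a = 1] (mod p))} = {0, x mod p}"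
    unfolding iff using p by (auto simp: Cong.cong_def)
  ultimately show ?thesis by simp
qed

lemma harm_le_1_plus_ln:
  assumes "n > 0"
  shows "harm n \<le> 1 + ln (real n)"
  using euler_mascheroni_sequence_decreasing[of 1 n] assms by (simp add: harm_def)

text \<open>Brun's sieve for x = \<open>2 ^ (64 * r ^ 3)\<close> with primes up to
  \<open>2 ^ J\<close>, \<open>J = 16 * r ^ 2\<close>, and level \<open>2 * r\<close>. The rounding
  errors are then of order sqrt x, the main term has \<open>1 / r ^ 4\<close> against log x of order
  \<open>r ^ 3\<close>, and \<open>(1/4) ^ r\<close> outweighs a power of \<open>r\<close>.\<close>

lemma card_twin_primes_le:
  fixes c :: nat
  assumes c: "c > 0"
  shows "\<exists>K>0. \<forall>r>0. \<forall>m\<in>{1..c}.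
    real (card {n. n < 2 ^ (64 * r ^ 3) \<and> prime n \<and> prime (m * n - 1)})
    \<le> 2 ^ (64 * r ^ 3) * (K / real r ^ 4 + (1 / 4) ^ r * exp (16 + 16 * ln (16 * real r ^ 2)))
      + 2 ^ (32 * r ^ 3) * exp 2 + 2 ^ (16 * r ^ 2) + 2"
proof -
  obtain K where K: "K > 0"
    "\<And>J. J > 0 \<Longrightarrow> (\<Prod>p | prime (p::nat) \<and> c < p \<and> p \<le> 2 ^ J. 1 - 2 / real p) \<le> K / real J ^ 2"
    using prod_primes_minus_two_le[OF c] by blast
  have "real (card {n. n < 2 ^ (64 * r ^ 3) \<and> prime n \<and> prime (m * n - 1)})
    \<le> 2 ^ (64 * r ^ 3) * (K / real r ^ 4 + (1 / 4) ^ r * exp (16 + 16 * ln (16 * real r ^ 2)))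
      + 2 ^ (32 * r ^ 3) * exp 2 + 2 ^ (16 * r ^ 2) + 2"
    if r: "r > 0" and m: "m \<in> {1..c}" for r m
  proof -
    define J where "J = 16 * r ^ 2"
    define X where "X = (2::nat) ^ (64 * r ^ 3)"
    define P where "P = {p::nat. prime p \<and> c < p \<and> p \<le> 2 ^ J}"
    define \<Omega> where "\<Omega> p = {a. a < p \<and> (a = 0 \<or> [m * a = 1] (mod p))}" for p
    define W where "W = {n. n < X \<and> (\<forall>p\<in>P. n mod p \<notin> \<Omega> p)}"
    have finP: "finite P" unfolding P_def by (rule finite_subset[of _ "{..2 ^ J}"]) auto
    have J: "J > 0" using r by (simp add: J_def)
    have cardP: "card P \<le> 2 ^ J"
    proof -
      have "P \<subseteq> {1..2 ^ J}" by (auto simp: P_def Suc_le_eq prime_gt_0_nat)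
      then show ?thesis using card_mono[of "{1..2 ^ J}" P] by simp
    qed
    have sieve: "real (card W) \<le> real X * ((\<Prod>p\<in>P. 1 - 2 / real p) + (1 / 4) ^ r * exp (4 * (\<Sum>p\<in>P. 1 / real p)))
        + (2 ^ J) ^ (2 * r) * exp 2"
      unfolding W_def
    proof (rule brun_sieve[OF finP])
      fix p assume p: "p \<in> P"
      then have "\<not> p dvd m" using m dvd_imp_le[of p m] by (auto simp: P_def)
      then show "card (\<Omega> p) = 2" unfolding \<Omega>_def using p by (intro card_twin_residues) (auto simp: P_def)
    qed (use cardP in \<open>auto simp: P_def \<Omega>_def of_nat_le_iff[of _ "2 ^ J", simplified, symmetric]\<close>)
    have main: "(\<Prod>p\<in>P. 1 - 2 / real p) \<le> K / real r ^ 4"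
    proof -
      have "(\<Prod>p\<in>P. 1 - 2 / real p) \<le> K / real J ^ 2" unfolding P_def by (rule K(2)[OF J])
      also have "\<dots> \<le> K / real r ^ 4"
        using K(1) r by (intro divide_left_mono) (auto simp: J_def power_mult_distrib simp flip: power_mult)
      finally show ?thesis .
    qed
    have "(\<Sum>p\<in>P. 1 / real p) \<le> (\<Sum>p | prime p \<and> p \<le> 2 ^ J. 1 / real p)"
      by (intro sum_mono2) (auto simp: P_def)
    also have "\<dots> \<le> 4 * harm J" by (rule sum_inverse_primes_pow2_le)
    also have "\<dots> \<le> 4 * (1 + ln (16 * real r ^ 2))"
      using harm_le_1_plus_ln[OF J] by (simp add: J_def)
    finally have rec: "exp (4 * (\<Sum>p\<in>P. 1 / real p)) \<le> exp (16 + 16 * ln (16 * real r ^ 2))" by simp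
    have lev: "((2::real) ^ J) ^ (2 * r) = 2 ^ (32 * r ^ 3)"
      by (simp add: J_def power2_eq_square power3_eq_cube mult_ac flip: power_mult)
    have cW: "real (card W) \<le> real X * (K / real r ^ 4 + (1 / 4) ^ r * exp (16 + 16 * ln (16 * real r ^ 2)))
        + 2 ^ (32 * r ^ 3) * exp 2"
      using sieve unfolding lev
      by (rule order_trans) (intro add_mono mult_left_mono main rec; simp)
    \<comment> \<open>For \<open>n > 2 ^ J + 1\<close> both primes exceed every sieving prime, so
      none of these divides them; the extra 1 is for \<open>m = 1\<close>. Smaller \<open>n\<close>
      are counted trivially.\<close>
    have "{n. n < X \<and> prime n \<and> prime (m * n - 1)} \<subseteq> W \<union> {..2 ^ J + 1}"
    proof
      fix n assume n: "n \<in> {n. n < X \<and> prime n \<and> prime (m * n - 1)}"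
      show "n \<in> W \<union> {..2 ^ J + 1}"
      proof (cases "n \<le> 2 ^ J + 1")
        case False
        have big: "m * n - 1 > 2 ^ J"
        proof -
          have "n \<le> m * n" using m by simp
          then show ?thesis using False by linarith
        qed
        have "n mod p \<notin> \<Omega> p" if p: "p \<in> P" for p
        proof
          assume "n mod p \<in> \<Omega> p"
          then consider "n mod p = 0" | "[m * (n mod p) = 1] (mod p)" by (auto simp: \<Omega>_def)
          then show False
          proof cases
            case 1
            then have "p = n" using n p by (auto simp: P_def primes_dvd_imp_eq mod_eq_0_iff_dvd)
            then show False using p False by (simp add: P_def)
          next
            case 2
            then have "[m * n = 1] (mod p)" by (simp add: Cong.cong_def mod_mult_right_eq)
            moreover have "1 \<le> m * n" using big by linarith
            ultimately have "p dvd m * n - 1" by (simp only: cong_altdef_nat)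
            then have "p = m * n - 1" using n p by (auto simp: P_def primes_dvd_imp_eq)
            then show False using p big by (simp add: P_def)
          qed
        qed
        then show ?thesis using n by (auto simp: W_def)
      qed simp
    qed
    moreover have "finite W" by (simp add: W_def)
    ultimately have "card {n. n < X \<and> prime n \<and> prime (m * n - 1)} \<le> card (W \<union> {..2 ^ J + 1})"
      by (intro card_mono) auto
    also have "\<dots> \<le> card W + (2 ^ J + 2)" using card_Un_le[of W "{..2 ^ J + 1}"] by simp
    finally have "real (card {n. n < X \<and> prime n \<and> prime (m * n - 1)}) \<le> real (card W + (2 ^ J + 2))"
      by (simp only: of_nat_le_iff)
    then show ?thesis using cW by (simp add: X_def J_def)
  qed
  then show ?thesis using K(1) by blast
qed

text \<open>Multiplied by \<open>64 * r ^ 3\<close>, which has the order of log x, every term of the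
  sieve bound is still o(x). The bound does not involve \<open>m\<close>, so one threshold for
  \<open>r\<close> serves all \<open>m\<close>.\<close>

lemma twin_primes_negligible:
  fixes c :: nat and \<epsilon> :: real
  assumes "c > 0" "\<epsilon> > 0"
  shows "\<forall>\<^sub>F r in sequentially. \<forall>m\<in>{1..c}.
    real (64 * r ^ 3) * real (card {n. n < 2 ^ (64 * r ^ 3) \<and> prime n \<and> prime (m * n - 1)}) \<le> \<epsilon> * 2 ^ (64 * r ^ 3)"
proof -
  obtain K where K: "K > 0" "\<And>r m. r > 0 \<Longrightarrow> m \<in> {1..c} \<Longrightarrow>
    real (card {n. n < 2 ^ (64 * r ^ 3) \<and> prime n \<and> prime (m * n - 1)})
    \<le> 2 ^ (64 * r ^ 3) * (K / real r ^ 4 + (1 / 4) ^ r * exp (16 + 16 * ln (16 * real r ^ 2)))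
      + 2 ^ (32 * r ^ 3) * exp 2 + 2 ^ (16 * r ^ 2) + 2"
    using card_twin_primes_le[OF assms(1)] by blast
  have "\<forall>\<^sub>F r::nat in sequentially. 64 * real r ^ 3 * (K / real r ^ 4 + (1 / 4) ^ r * exp (16 + 16 * ln (16 * real r ^ 2))) < \<epsilon> / 4"
    using assms(2) K(1) by real_asymp
  moreover have "\<forall>\<^sub>F r::nat in sequentially. 64 * real r ^ 3 * 2 powr (32 * real r ^ 3) * exp 2 < \<epsilon> / 4 * 2 powr (64 * real r ^ 3)"
    using assms(2) by real_asymp
  moreover have "\<forall>\<^sub>F r::nat in sequentially. 64 * real r ^ 3 * (2 powr (16 * real r ^ 2) + 2) < \<epsilon> / 4 * 2 powr (64 * real r ^ 3)"
    using assms(2) by real_asymp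
  moreover have "\<forall>\<^sub>F r::nat in sequentially. r > 0" by (rule eventually_gt_at_top)
  ultimately show ?thesis
  proof eventually_elim
    case (elim r)
    have pw: "2 powr (32 * real r ^ 3) = 2 ^ (32 * r ^ 3)" "2 powr (64 * real r ^ 3) = 2 ^ (64 * r ^ 3)"
      "2 powr (16 * real r ^ 2) = 2 ^ (16 * r ^ 2)"
      using powr_realpow[of 2 "32 * r ^ 3"] powr_realpow[of 2 "64 * r ^ 3"] powr_realpow[of 2 "16 * r ^ 2"] by simp_all
    define E where "E = K / real r ^ 4 + (1 / 4) ^ r * exp (16 + 16 * ln (16 * real r ^ 2))"
    define x where "x = (2::real) ^ (64 * r ^ 3)"
    have x: "x > 0" by (simp add: x_def)
    have e1: "64 * real r ^ 3 * E * x \<le> \<epsilon> / 4 * x" using elim(1) x unfolding E_def by (intro mult_right_mono) auto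
    show ?case
    proof
      fix m assume m: "m \<in> {1..c}"
      have "real (64 * r ^ 3) * real (card {n. n < 2 ^ (64 * r ^ 3) \<and> prime n \<and> prime (m * n - 1)})
        \<le> real (64 * r ^ 3) * (x * E + 2 ^ (32 * r ^ 3) * exp 2 + 2 ^ (16 * r ^ 2) + 2)"
        using K(2)[OF elim(4) m] unfolding E_def x_def by (intro mult_left_mono) auto
      also have "\<dots> = 64 * real r ^ 3 * E * x + 64 * real r ^ 3 * 2 ^ (32 * r ^ 3) * exp 2 + 64 * real r ^ 3 * (2 ^ (16 * r ^ 2) + 2)"
        by (simp add: algebra_simps)
      also have "\<dots> \<le> \<epsilon> / 4 * x + \<epsilon> / 4 * x + \<epsilon> / 4 * x"
        using e1 elim(2,3) unfolding pw x_def by linarith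
      also have "\<dots> \<le> \<epsilon> * x" using x assms(2) by simp
      finally show "real (64 * r ^ 3) * real (card {n. n < 2 ^ (64 * r ^ 3) \<and> prime n \<and> prime (m * n - 1)}) \<le> \<epsilon> * 2 ^ (64 * r ^ 3)"
        unfolding x_def .
    qed
  qed
qed

section \<open>Prime sets with k-th power divisor sums\<close>

text \<open>At least \<open>2 ^ N / (2 * N)\<close> primes survive the exclusions and form
  \<open>I\<close>, while \<open>P\<close> has at most \<open>12 * 2 ^ (N - j) / N\<close> elements.
  For \<open>j\<close> large compared with \<open>R\<close> the zero-sum theorem applies.\<close>

lemma kth_power_prime_set:
  fixes F :: "nat set"
  assumes k: "k \<ge> 2" and F: "finite F"
  shows "\<exists>S. finite S \<and> S \<noteq> {} \<and> S \<inter> F = {} \<and> (\<forall>p\<in>S. prime p) \<and> is_nth_power k (\<Prod>p\<in>S. Suc p)"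
proof -
  obtain R where R: "R > 0" "\<And>P I. finite P \<Longrightarrow> finite I \<Longrightarrow> R * card P < card I \<Longrightarrow>
    (\<forall>i\<in>I. Suc i > 0 \<and> prime_factors (Suc i) \<subseteq> P) \<Longrightarrow>
    \<exists>S\<subseteq>I. S \<noteq> {} \<and> is_nth_power k (\<Prod>i\<in>S. Suc i)"
    using kth_power_subproduct[OF k, of Suc] by metis
  \<comment> \<open>What matters is \<open>24 * R < 2 ^ j\<close>: the constant 6 of the upper bound
    doubles because \<open>N \<le> 2 * (N - j)\<close>, and again because only half of
    \<open>2 ^ N\<close> is left for \<open>I\<close>.\<close>
  define j where "j = 24 * R"
  define c where "c = (2::nat) ^ j"
  have c: "c > 0" by (simp add: c_def)
  have jc: "24 * R < c" unfolding c_def j_def by (rule less_exp)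
  \<comment> \<open>Budget: the \<open>c\<close> families of exceptional primes together get a
    quarter of \<open>2 ^ N\<close>; \<open>F\<close>, the two endpoints and the \<open>- 1\<close>
    of the lower bound get another quarter.\<close>
  have "\<forall>\<^sub>F r in sequentially. \<forall>m\<in>{1..c}.
    real (64 * r ^ 3) * real (card {n. n < 2 ^ (64 * r ^ 3) \<and> prime n \<and> prime (m * n - 1)}) \<le> 1 / (4 * real c) * 2 ^ (64 * r ^ 3)"
    using c by (intro twin_primes_negligible) auto
  moreover have "\<forall>\<^sub>F r::nat in sequentially. 64 * real r ^ 3 * (real (card F) + 2) + 1 \<le> 1 / 4 * 2 powr (64 * real r ^ 3)"
    by real_asymp
  moreover have "\<forall>\<^sub>F r::nat in sequentially. r > 2 * j" by (rule eventually_gt_at_top)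
  ultimately have ev: "\<forall>\<^sub>F r in sequentially. (\<forall>m\<in>{1..c}.
    real (64 * r ^ 3) * real (card {n. n < 2 ^ (64 * r ^ 3) \<and> prime n \<and> prime (m * n - 1)}) \<le> 1 / (4 * real c) * 2 ^ (64 * r ^ 3)) \<and>
    64 * real r ^ 3 * (real (card F) + 2) + 1 \<le> 1 / 4 * 2 powr (64 * real r ^ 3) \<and> r > 2 * j"
    by eventually_elim blast
  obtain r where r: "\<And>m. m \<in> {1..c} \<Longrightarrow>
    real (64 * r ^ 3) * real (card {n. n < 2 ^ (64 * r ^ 3) \<and> prime n \<and> prime (m * n - 1)}) \<le> 1 / (4 * real c) * 2 ^ (64 * r ^ 3)"
    "64 * real r ^ 3 * (real (card F) + 2) + 1 \<le> 1 / 4 * 2 powr (64 * real r ^ 3)" "r > 2 * j"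
    using eventually_happens'[OF sequentially_bot ev] by blast
  define N where "N = 64 * r ^ 3"
  define tw where "tw m = {n. n < 2 ^ N \<and> prime n \<and> prime (m * n - 1)}" for m :: nat
  have N2j: "2 * j < N"
  proof -
    have "r \<le> r ^ 3" using r(3) by (intro self_le_power) auto
    then show ?thesis using r(3) by (simp add: N_def)
  qed
  have twin: "real N * real (card (tw m)) \<le> 1 / (4 * real c) * 2 ^ N" if "m \<in> {1..c}" for m
    using r(1)[OF that] unfolding N_def tw_def .
  have small: "real N * (real (card F) + 2) + 1 \<le> 1 / 4 * 2 ^ N"
    using r(2) powr_realpow[of 2 N] unfolding N_def by simp
  define P where "P = {p::nat. prime p \<and> p \<le> 2 ^ (N - j)}"
  define I where "I = {p::nat. prime p \<and> p \<le> 2 ^ N \<and> p \<notin> F \<and> prime_factors (Suc p) \<subseteq> P}"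
  have finI: "finite I" unfolding I_def by (rule finite_subset[of _ "{..2 ^ N}"]) auto
  have fintw: "finite (tw m)" for m unfolding tw_def by auto
  have cN: "c * 2 ^ (N - j) = 2 ^ N" unfolding c_def using N2j by (simp flip: power_add)
  \<comment> \<open>Setting the two endpoints aside gives \<open>Suc p < 2 ^ N\<close>. If
    \<open>Suc p = m * q\<close> with a prime \<open>q > 2 ^ (N - j)\<close>, then
    \<open>q \<in> tw m\<close> and \<open>m \<le> c\<close>.\<close>
  have cover: "{p. prime p \<and> p \<le> 2 ^ N} \<subseteq> I \<union> F \<union> {2 ^ N - 1, 2 ^ N} \<union> (\<Union>m\<in>{1..c}. (\<lambda>n. m * n - 1) ` tw m)"
  proof
    fix p :: nat assume "p \<in> {p. prime p \<and> p \<le> 2 ^ N}"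
    then have p: "prime p" "p \<le> 2 ^ N" by auto
    show "p \<in> I \<union> F \<union> {2 ^ N - 1, 2 ^ N} \<union> (\<Union>m\<in>{1..c}. (\<lambda>n. m * n - 1) ` tw m)"
    proof (cases "p \<in> I \<union> F \<union> {2 ^ N - 1, 2 ^ N}")
      case False
      then have less: "Suc p < 2 ^ N" using p by auto
      from False p have "\<not> prime_factors (Suc p) \<subseteq> P" by (auto simp: I_def)
      then obtain q where "q \<in> prime_factors (Suc p)" "q \<notin> P" by blast
      then have q: "prime q" "q dvd Suc p" "2 ^ (N - j) < q"
        by (auto simp: P_def in_prime_factors_iff)
      then obtain m where m: "Suc p = m * q" by (metis dvd_def mult.commute)
      then have m0: "m > 0" by (cases m) auto
      have "q \<le> Suc p" using q(2) by (rule dvd_imp_le) simp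
      then have "q \<in> tw m" using q p less m[symmetric] by (simp add: tw_def)
      moreover have "m * 2 ^ (N - j) \<le> c * 2 ^ (N - j)"
      proof -
        have "m * 2 ^ (N - j) \<le> m * q" using q(3) by (intro mult_left_mono) auto
        also have "\<dots> \<le> 2 ^ N" using m less by simp
        finally show ?thesis unfolding cN .
      qed
      then have "m \<in> {1..c}" using m0 by simp
      moreover have "p = m * q - 1" using m by simp
      ultimately show ?thesis by blast
    qed blast
  qed
  have "prime_count (2 ^ N) \<le> card (I \<union> F \<union> {2 ^ N - 1, 2 ^ N} \<union> (\<Union>m\<in>{1..c}. (\<lambda>n. m * n - 1) ` tw m))"
    unfolding prime_count_def using finI F fintw by (intro card_mono cover) auto
  also have "\<dots> \<le> card I + card F + 2 + (\<Sum>m\<in>{1..c}. card (tw m))"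
  proof -
    have "card (\<Union>m\<in>{1..c}. (\<lambda>n. m * n - 1) ` tw m) \<le> (\<Sum>m\<in>{1..c}. card ((\<lambda>n. m * n - 1) ` tw m))"
      by (rule card_UN_le) simp
    also have "\<dots> \<le> (\<Sum>m\<in>{1..c}. card (tw m))" by (intro sum_mono card_image_le fintw)
    finally show ?thesis
      using card_Un_le[of "I \<union> F \<union> {2 ^ N - 1, 2 ^ N}" "\<Union>m\<in>{1..c}. (\<lambda>n. m * n - 1) ` tw m"]
        card_Un_le[of "I \<union> F" "{2 ^ N - 1, 2 ^ N}"] card_Un_le[of I F] card_insert_le_m1[of 2 "{2 ^ N}" "2 ^ N - 1 :: nat"]
      by simp
  qed
  finally have "real (prime_count (2 ^ N)) \<le> real (card I + card F + 2 + (\<Sum>m\<in>{1..c}. card (tw m)))"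
    by (simp only: of_nat_le_iff)
  then have "real N * real (prime_count (2 ^ N)) \<le> real N * real (card I + card F + 2 + (\<Sum>m\<in>{1..c}. card (tw m)))"
    by (rule mult_left_mono) simp
  also have "\<dots> = real N * real (card I) + real N * (real (card F) + 2) + (\<Sum>m\<in>{1..c}. real N * real (card (tw m)))"
    by (simp add: sum_distrib_left algebra_simps)
  also have "(\<Sum>m\<in>{1..c}. real N * real (card (tw m))) \<le> (\<Sum>m\<in>{1..c}. 1 / (4 * real c) * 2 ^ N)"
    by (intro sum_mono twin)
  also have "\<dots> = 1 / 4 * 2 ^ N" using c by simp
  finally have "real N * real (card I) \<ge> 1 / 2 * 2 ^ N"
    using prime_count_pow2_ge[of N] N2j small by simp
  moreover have "real N * real (R * card P) < 1 / 2 * 2 ^ N"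
  proof -
    have "N \<le> 2 * (N - j)" using N2j by linarith
    then have "N * card P \<le> 2 * ((N - j) * card P)"
      using mult_right_mono[of N "2 * (N - j)" "card P"] by simp
    also have "\<dots> \<le> 2 * (6 * 2 ^ (N - j))"
      using prime_count_pow2_le[of "N - j"] N2j unfolding P_def prime_count_def by simp
    finally have "2 * R * (N * card P) \<le> 2 * R * (12 * 2 ^ (N - j))" by (intro mult_left_mono) auto
    also have "\<dots> = 24 * R * 2 ^ (N - j)" by simp
    also have "\<dots> < c * 2 ^ (N - j)" using jc by simp
    also have "\<dots> = 2 ^ N" by (rule cN)
    finally have "real (2 * R * (N * card P)) < real (2 ^ N)" by (simp only: of_nat_less_iff)
    then show ?thesis by (simp add: mult_ac)
  qed
  ultimately have "real N * real (R * card P) < real N * real (card I)" by linarith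
  then have "R * card P < card I" by (simp flip: of_nat_mult)
  moreover have "finite P" by (simp add: P_def)
  moreover have "\<forall>i\<in>I. Suc i > 0 \<and> prime_factors (Suc i) \<subseteq> P" by (simp add: I_def)
  ultimately obtain S where S: "S \<subseteq> I" "S \<noteq> {}" "is_nth_power k (\<Prod>i\<in>S. Suc i)"
    using R(2)[of P I] finI by blast
  have "finite S" using S(1) finI by (rule finite_subset)
  moreover have "S \<inter> F = {}" "\<forall>p\<in>S. prime p" using S(1) by (auto simp: I_def)
  ultimately show ?thesis using S(2,3) by (intro exI[of _ S] conjI)
qed

text \<open>The sets form a growing chain, so the difference of any two members is a candidate;
  strict growth makes it nonempty, and pigeonhole on the products modulo \<open>a\<close> picks the
  pair.\<close>

lemma kth_power_prime_set_cong_1: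
  fixes F :: "nat set"
  assumes k: "k \<ge> 2" and F: "finite F" and a: "a > 0"
  shows "\<exists>S. finite S \<and> S \<noteq> {} \<and> S \<inter> F = {} \<and> (\<forall>p\<in>S. prime p) \<and>
    is_nth_power k (\<Prod>p\<in>S. Suc p) \<and> [\<Prod>S = 1] (mod a)"
proof -
  \<comment> \<open>Keeping the prime factors of \<open>a\<close> out makes
    \<open>\<Prod>(f i)\<close> invertible modulo \<open>a\<close>, which allows the cancellation at
    the end.\<close>
  define G where "G = F \<union> prime_factors a"
  have G: "finite G" using F by (simp add: G_def)
  define Q where "Q T = (finite T \<and> T \<inter> G = {} \<and> (\<forall>p\<in>T. prime p))" for T :: "nat set"
  define E where "E T U \<longleftrightarrow> T \<subset> U \<and> is_nth_power k (\<Prod>p\<in>U - T. Suc p)" for T U :: "nat set"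
  have "\<exists>f. \<forall>n. Q (f n) \<and> E (f n) (f (Suc n))"
  proof (rule dependent_nat_choice)
    show "\<exists>T. Q T" by (auto simp: Q_def intro!: exI[of _ "{}"])
  next
    fix T :: "nat set" and n :: nat assume T: "Q T"
    then have "finite (G \<union> T)" using G by (simp add: Q_def)
    from kth_power_prime_set[OF k this] obtain S where S: "finite S" "S \<noteq> {}" "S \<inter> (G \<union> T) = {}"
      "\<forall>p\<in>S. prime p" "is_nth_power k (\<Prod>p\<in>S. Suc p)" by blast
    then have "(T \<union> S) - T = S" by auto
    then show "\<exists>U. Q U \<and> E T U" using S T by (intro exI[of _ "T \<union> S"]) (auto simp: Q_def E_def)
  qed
  then obtain f where f: "\<And>n. Q (f n)" "\<And>n. E (f n) (f (Suc n))" by blast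
  have chain: "E (f i) (f j)" if "i < j" for i j
    using that
  proof (induction j)
    case (Suc j)
    show ?case
    proof (cases "i = j")
      case False
      then have E: "E (f i) (f j)" using Suc by simp
      have sub: "f i \<subset> f j" "f j \<subset> f (Suc j)" using E f(2)[of j] by (auto simp: E_def)
      have "f (Suc j) - f i = (f j - f i) \<union> (f (Suc j) - f j)" using sub by auto
      then have "(\<Prod>p\<in>f (Suc j) - f i. Suc p) = (\<Prod>p\<in>f j - f i. Suc p) * (\<Prod>p\<in>f (Suc j) - f j. Suc p)"
        using f(1) by (simp only:) (rule prod.union_disjoint, auto simp: Q_def)
      then show ?thesis using E f(2)[of j] sub unfolding E_def by (auto intro: is_nth_power_mult)
    qed (use f in simp)
  qed simp
  define t where "t n = \<Prod>(f n) mod a" for n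
  have "t ` {..a} \<subseteq> {..<a}" using a by (auto simp: t_def)
  then have "card (t ` {..a}) \<le> a" using card_mono[of "{..<a}"] by force
  then have "\<not> inj_on t {..a}" using card_image[of t "{..a}"] by auto
  then obtain i j where ij: "i < j" "t i = t j" unfolding inj_on_def by (metis linorder_neqE_nat)
  define S where "S = f j - f i"
  have E: "f i \<subset> f j" "is_nth_power k (\<Prod>p\<in>S. Suc p)" using chain[OF ij(1)] by (auto simp: E_def S_def)
  have S: "finite S" "S \<noteq> {}" "S \<inter> G = {}" "\<forall>p\<in>S. prime p" using f(1)[of j] E by (auto simp: S_def Q_def)
  have cop: "coprime (\<Prod>(f i)) a"
  proof (rule prod_coprime_left)
    fix p assume "p \<in> f i"
    then have "prime p" "p \<notin> prime_factors a" using f(1)[of i] by (auto simp: Q_def G_def)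
    then show "coprime p a" using a by (auto simp: in_prime_factors_iff intro: prime_imp_coprime)
  qed
  have "\<Prod>(f j) = \<Prod>(f i) * \<Prod>S"
    unfolding S_def using E f(1) by (subst prod.subset_diff[of "f i"]) (auto simp: Q_def mult.commute)
  then have "[\<Prod>(f i) * \<Prod>S = \<Prod>(f i) * 1] (mod a)"
    using ij(2) by (simp add: t_def Cong.cong_def)
  then have "[\<Prod>S = 1] (mod a)" using cop by (simp only: cong_mult_lcancel_nat)
  then show ?thesis using S E by (intro exI[of _ S]) (auto simp: G_def)
qed

section \<open>Divisor sums of products with new primes, and the theorem\<close>

lemma sigma_mult_prime:
  assumes "prime p" "\<not> p dvd n"
  shows "sigma (n * p) = sigma n * Suc p"
proof -
  have n: "n > 0" using assms(2) by (cases n) auto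
  have p: "p > 0" using assms(1) by (rule prime_gt_0_nat)
  \<comment> \<open>The divisors split by whether \<open>p\<close> divides them; the two sets are
    disjoint as \<open>p\<close> does not divide \<open>n\<close>.\<close>
  have "{d. d dvd n * p} = {d. d dvd n} \<union> (\<lambda>d. p * d) ` {d. d dvd n}"
  proof (intro equalityI subsetI)
    fix d assume d: "d \<in> {d. d dvd n * p}"
    show "d \<in> {d. d dvd n} \<union> (\<lambda>d. p * d) ` {d. d dvd n}"
    proof (cases "p dvd d")
      case True
      then obtain e where "d = p * e" by (auto elim: dvdE)
      then show ?thesis using d p by (auto simp: mult.commute)
    next
      case False
      then have "coprime d p" using assms(1) by (metis coprime_commute prime_imp_coprime)
      then show ?thesis using d by (simp add: coprime_dvd_mult_left_iff)
    qed
  qed auto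
  then have "sigma (n * p) = \<Sum>{d. d dvd n} + \<Sum>((\<lambda>d. p * d) ` {d. d dvd n})"
    unfolding sigma_def using n assms(2) by (simp only:) (rule sum.union_disjoint, auto)
  also have "\<Sum>((\<lambda>d. p * d) ` {d. d dvd n}) = p * \<Sum>{d. d dvd n}"
    using p by (subst sum.reindex) (auto simp: inj_on_def sum_distrib_left)
  finally show ?thesis by (simp add: sigma_def mult.commute)
qed

lemma sigma_mult_primes:
  assumes "finite S" "\<forall>p\<in>S. prime p" "\<forall>p\<in>S. \<not> p dvd n"
  shows "sigma (n * \<Prod>S) = sigma n * (\<Prod>p\<in>S. Suc p)"
  using assms
proof (induction S rule: finite_induct)
  case (insert p S)
  have "\<not> p dvd \<Prod>S"
  proof
    assume "p dvd \<Prod>S"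
    then obtain q where "q \<in> S" "p dvd q" using insert.hyps(1) insert.prems(1) by (auto simp: prime_dvd_prod_iff)
    then show False using primes_dvd_imp_eq[of p q] insert.hyps(2) insert.prems(1) by auto
  qed
  then have "\<not> p dvd n * \<Prod>S" using insert.prems by (simp add: prime_dvd_mult_iff)
  then have "sigma (n * \<Prod>S * p) = sigma (n * \<Prod>S) * Suc p"
    using sigma_mult_prime[of p "n * \<Prod>S"] insert.prems(1) by blast
  then show ?case using insert by (simp add: mult_ac)
qed simp

theorem theorem2:
  fixes a b k :: nat
  assumes "a \<ge> 1" and "k \<ge> 2"
  shows "(\<forall>n::nat. n \<ge> 1 \<longrightarrow> \<not> is_kth_power k (sigma (a * n + b)))
         \<or> infinite {n::nat. n \<ge> 1 \<and> is_kth_power k (sigma (a * n + b))}"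
proof (rule disjCI)
  assume "\<not> infinite {n::nat. n \<ge> 1 \<and> is_kth_power k (sigma (a * n + b))}"
  then obtain m where m: "\<And>n. n \<ge> 1 \<Longrightarrow> is_kth_power k (sigma (a * n + b)) \<Longrightarrow> n \<le> m"
    unfolding finite_nat_set_iff_bounded_le by auto
  show "\<forall>n::nat. n \<ge> 1 \<longrightarrow> \<not> is_kth_power k (sigma (a * n + b))"
  proof (intro allI impI notI)
    fix n :: nat assume n: "n \<ge> 1" "is_kth_power k (sigma (a * n + b))"
    define N where "N = a * n + b"
    have N: "N > 0" using n(1) assms(1) by (simp add: N_def)
    have "a > 0" using assms(1) by simp
    \<comment> \<open>Avoiding everything up to \<open>N + a * m + b\<close> serves twice: the
      primes in \<open>S\<close> do not divide \<open>N\<close>, and \<open>N * \<Prod>S\<close>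
      lies beyond \<open>a * m + b\<close>, the largest argument that the bound \<open>m\<close>
      permits.\<close>
    from kth_power_prime_set_cong_1[OF assms(2) finite_atMost[of "N + a * m + b"] this]
    obtain S where S: "finite S" "S \<noteq> {}" "S \<inter> {..N + a * m + b} = {}" "\<forall>p\<in>S. prime p"
      "is_nth_power k (\<Prod>p\<in>S. Suc p)" "[\<Prod>S = 1] (mod a)" by blast
    have big: "p > N + a * m + b" if "p \<in> S" for p
    proof -
      have "p \<notin> {..N + a * m + b}" using S(3) that by blast
      then show ?thesis by simp
    qed
    have ge1: "\<Prod>S \<ge> 1" using S(4) by (simp add: Suc_le_eq prime_gt_0_nat prod_pos)
    have "a dvd \<Prod>S - 1" using S(6) ge1 by (simp only: cong_altdef_nat)
    then obtain u where u: "\<Prod>S - 1 = a * u" by (auto elim: dvdE)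
    \<comment> \<open>Writing \<open>\<Prod>S = a * u + 1\<close> exhibits the new argument in the
      progression, with index \<open>n + N * u\<close>.\<close>
    have M: "N * \<Prod>S = a * (n + N * u) + b"
    proof -
      have "\<Prod>S = a * u + 1" using u ge1 by simp
      then show ?thesis by (simp add: N_def algebra_simps)
    qed
    have "\<not> p dvd N" if "p \<in> S" for p using big[OF that] N dvd_imp_le[of p N] by linarith
    then have "sigma (N * \<Prod>S) = sigma N * (\<Prod>p\<in>S. Suc p)"
      using S(1,4) by (intro sigma_mult_primes) blast+
    moreover have "is_nth_power k (sigma N * (\<Prod>p\<in>S. Suc p))"
      using n(2) S(5) by (intro is_nth_power_mult) (auto simp: N_def is_kth_power_def is_nth_power_def)
    ultimately have "is_kth_power k (sigma (a * (n + N * u) + b))"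
      unfolding M by (simp add: is_kth_power_def is_nth_power_def)
    then have le: "n + N * u \<le> m" using n(1) by (intro m) auto
    obtain p where p: "p \<in> S" using S(2) by blast
    have "p \<le> \<Prod>S" using dvd_imp_le[OF dvd_prodI[OF S(1) p, of "\<lambda>p. p"]] ge1 by linarith
    also have "\<dots> \<le> N * \<Prod>S" using N by simp
    also have "\<dots> \<le> a * m + b" unfolding M using le by simp
    finally show False using big[OF p] by simp
  qed
qed

end
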